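(* Let $d\ge 2$ be an integer and let $\mu^0_{n,d}$ be the uniform probability measure on the set $\mathcal{L}^0_{n,d}$ of $1$-Lipschitz functions $f\colon V(\mathbb{T}^n_d)\to\mathbb{Z}$ that take the value $0$ at every vertex at distance exactly $n$ from the root. Then $\mu^0_{n,d}$ converges (in the local weak sense) as $n\to\infty$ if and only if $2\le d\le 7$.
   Context: A $d$-ary tree $\mathbb{T}_d$ is an infinite tree with a distinguished root vertex $\rho$ of degree $d$, all other vertices having degree $d+1$. $\mathbb{T}^n_d$ is the finite subtree induced by the vertices at graph distance at most $n$ from $\rho$; its leaves are the vertices at distance exactly $n$. A function $f$ on the vertices of a graph is $1$-Lipschitz (integer-valued) if $f$ takes values in $\mathbb{Z}$ and $|f(u)-f(v)|\le 1$ for all adjacent $u,v$. Local weak convergence of $\mu^0_{n,d}$ means: for every fixed $r\ge 0$, the law under $\mu^0_{n,d}$ of the restriction of $f$ to the vertices within distance $r$ of $\rho$ converges, as $n\to\infty$, to a probability measure. *)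

theory Defs
  imports "HOL-Probability.Probability"
begin

text \<open>Vertices of the finite d-ary tree of depth n: words over the alphabet
  {0..<d} of length at most n; the root is the empty word and the children of v
  are the words v @ [i] with i < d. Graph distance from the root is the length.\<close>
definition tree_verts :: "nat \<Rightarrow> nat \<Rightarrow> nat list set" where
  "tree_verts d n = {v. length v \<le> n \<and> set v \<subseteq> {..<d}}"

text \<open>Integer-valued 1-Lipschitz functions on the tree of depth n vanishing at the
  leaves (distance n from the root). Functions are normalised to 0 outside the
  vertex set, so that they are in bijection with functions on the vertex set.\<close>
definition lip0 :: "nat \<Rightarrow> nat \<Rightarrow> (nat list \<Rightarrow> int) set" where
  "lip0 d n = {f.
     (\<forall>v\<in>tree_verts d n. \<forall>i<d. length v < n \<longrightarrow> \<bar>f (v @ [i]) - f v\<bar> \<le> 1) \<and>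
     (\<forall>v\<in>tree_verts d n. length v = n \<longrightarrow> f v = 0) \<and>
     (\<forall>v. v \<notin> tree_verts d n \<longrightarrow> f v = 0)}"

definition restrict_ball :: "nat \<Rightarrow> nat \<Rightarrow> (nat list \<Rightarrow> int) \<Rightarrow> (nat list \<Rightarrow> int)" where
  "restrict_ball d r f = (\<lambda>v. if v \<in> tree_verts d r then f v else 0)"

definition mu_local :: "nat \<Rightarrow> nat \<Rightarrow> nat \<Rightarrow> (nat list \<Rightarrow> int) pmf" where
  "mu_local d n r = map_pmf (restrict_ball d r) (pmf_of_set (lip0 d n))"

text \<open>Local weak convergence: for each r, the laws of the r-ball restrictions converge
  to a probability measure. The restrictions live in a countable discrete space, where
  weak convergence to a probability measure is convergence of every point mass.\<close>
definition local_weak_conv :: "nat \<Rightarrow> bool" where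
  "local_weak_conv d \<longleftrightarrow>
     (\<forall>r. \<exists>P :: (nat list \<Rightarrow> int) pmf. \<forall>g.
        (\<lambda>n. pmf (mu_local d n r) g) \<longlonglongrightarrow> pmf P g)"

end

theory Submission
  imports Defs
begin

text \<open>Let \<open>Z\<^sub>n(k)\<close> count the functions with value \<open>k\<close> at the root, so that
  \<open>Z\<^sub>n\<^sub>+\<^sub>1(k) = (Z\<^sub>n(k-1) + Z\<^sub>n(k) + Z\<^sub>n(k+1))\<^sup>d\<close>. In terms of the profile
  \<open>p\<^sub>n(k) = (Z\<^sub>n\<^sub>+\<^sub>1(k) / Z\<^sub>n\<^sub>+\<^sub>1(0))\<^sup>1\<^sup>/\<^sup>d\<close> the recursion is
  \<open>p(k) \<mapsto> (p(k-1)\<^sup>d + p(k)\<^sup>d + p(k+1)\<^sup>d) / (1 + 2 p(1)\<^sup>d)\<close> for \<open>k \<ge> 1\<close>. Up to the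
  small contribution of \<open>p(2)\<close>, the first entry evolves by \<open>u \<mapsto> (1 + u\<^sup>d) / (1 + 2 u\<^sup>d)\<close>, whose slope
  is below 1 on the whole unit interval for \<open>d \<le> 7\<close> (about 0.986 at worst for \<open>d = 7\<close>). On an
  invariant box the full recursion is then a contraction in the supremum norm, so all ratios
  \<open>Z\<^sub>n(k) / Z\<^sub>n(0)\<close> converge, and geometric decay in \<open>k\<close> gives tightness. For \<open>d \<ge> 8\<close>
  the first entry is trapped near a cycle of length two: \<open>Z\<^sub>n(1) / Z\<^sub>n(0)\<close> is at least
  0.45 for odd \<open>n\<close> and at most \<open>0.7633\<^sup>d < 0.2\<close> for even \<open>n\<close>.\<close>

section \<open>Counting Lipschitz functions by subtrees\<close>

lemma tree_verts_Nil [simp]: "[] \<in> tree_verts d n"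
  by (simp add: tree_verts_def)

lemma tree_verts_Cons_0 [simp]: "i # v \<notin> tree_verts d 0"
  by (simp add: tree_verts_def)

lemma tree_verts_Cons_Suc [simp]:
  "i # v \<in> tree_verts d (Suc n) \<longleftrightarrow> i < d \<and> v \<in> tree_verts d n"
  by (auto simp: tree_verts_def)

lemma restrict_ball_Nil [simp]: "restrict_ball d r f [] = f []"
  by (simp add: restrict_ball_def)

lemma restrict_ball_0: "restrict_ball d 0 f = (\<lambda>v. if v = [] then f [] else 0)"
  by (auto simp: restrict_ball_def tree_verts_def fun_eq_iff)

lemma fun_list_eq_iff: "f = g \<longleftrightarrow> f [] = g [] \<and> (\<forall>i v. f (i # v) = g (i # v))"
  by (metis ext list.exhaust)

lemma restrict_ball_Suc_eq_iff:
  "restrict_ball d (Suc r) f = g \<longleftrightarrow>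
     f [] = g [] \<and> (\<forall>i<d. restrict_ball d r (\<lambda>v. f (i # v)) = (\<lambda>v. g (i # v))) \<and>
     (\<forall>i v. d \<le> i \<longrightarrow> g (i # v) = 0)"
  unfolding fun_list_eq_iff[of "restrict_ball d (Suc r) f"]
  by (auto simp: restrict_ball_def fun_eq_iff not_less) (metis not_less)+

lemma lip0_0: "lip0 d 0 = {\<lambda>_. 0}"
  unfolding lip0_def tree_verts_def by (auto simp: fun_eq_iff) (metis)

text \<open>Cutting a word at its front sorts the vertices below the root into \<open>d\<close>
  subtrees, while children are appended at the back. Hence every edge lies inside one subtree,
  except the \<open>d\<close> edges at the root, and leaves at depth \<open>Suc n\<close> become
  leaves at depth \<open>n\<close>.\<close>

lemma lip0_Suc_iff:
  "f \<in> lip0 d (Suc n) \<longleftrightarrow>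
     (\<forall>i<d. (\<lambda>v. f (i # v)) \<in> lip0 d n \<and> \<bar>f [i] - f []\<bar> \<le> 1) \<and>
     (\<forall>i v. d \<le> i \<longrightarrow> f (i # v) = 0)" (is "?L \<longleftrightarrow> ?R")
proof
  assume L: ?L
  have lip: "\<bar>f (v @ [i]) - f v\<bar> \<le> 1"
    if "v \<in> tree_verts d (Suc n)" "i < d" "length v < Suc n" for v i
    using L that by (simp add: lip0_def)
  have leaf: "f v = 0" if "v \<in> tree_verts d (Suc n)" "length v = Suc n" for v
    using L that by (simp add: lip0_def)
  have out: "f v = 0" if "v \<notin> tree_verts d (Suc n)" for v
    using L that by (simp add: lip0_def)
  show ?R
  proof (intro conjI allI impI)
    fix i assume i: "i < d"
    show "(\<lambda>v. f (i # v)) \<in> lip0 d n"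
      using i lip[of "i # _"] leaf[of "i # _"] out[of "i # _"] by (simp add: lip0_def)
    show "\<bar>f [i] - f []\<bar> \<le> 1"
      using lip[of "[]" i] i by simp
  next
    fix i v assume "d \<le> i"
    then show "f (i # v) = 0" using out[of "i # v"] by simp
  qed
next
  assume R: ?R
  have sub: "(\<lambda>v. f (i # v)) \<in> lip0 d n" "\<bar>f [i] - f []\<bar> \<le> 1" if "i < d" for i
    using R that by blast+
  have out: "f (i # v) = 0" if "d \<le> i" for i v
    using R that by blast
  show ?L
    unfolding lip0_def mem_Collect_eq
  proof (intro conjI ballI allI impI)
    fix v i assume v: "v \<in> tree_verts d (Suc n)" and i: "i < d" "length v < Suc n"
    show "\<bar>f (v @ [i]) - f v\<bar> \<le> 1"
      using v i sub by (cases v) (auto simp: lip0_def)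
  next
    fix v assume v: "v \<in> tree_verts d (Suc n)" "length v = Suc n"
    then show "f v = 0"
      using sub(1) by (cases v) (auto simp: lip0_def)
  next
    fix v assume v: "v \<notin> tree_verts d (Suc n)"
    then obtain i w where w: "v = i # w" by (cases v) auto
    then show "f v = 0"
      using v sub(1)[of i] out[of i w] by (cases "i < d") (auto simp: lip0_def)
  qed
qed

text \<open>Following the first child \<open>n\<close> times leads to a leaf, where the value is 0,
  and each edge changes the value by at most 1.\<close>

lemma lip0_root_bound:
  assumes "0 < d" "f \<in> lip0 d n"
  shows "\<bar>f []\<bar> \<le> int n"
  using assms(2)
proof (induction n arbitrary: f)
  case 0
  then show ?case by (simp add: lip0_0)
next
  case (Suc n)
  then have "(\<lambda>v. f (0 # v)) \<in> lip0 d n" "\<bar>f [0] - f []\<bar> \<le> 1"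
    using assms(1) by (auto simp: lip0_Suc_iff)
  with Suc.IH[of "\<lambda>v. f (0 # v)"] show ?case by simp
qed

text \<open>The inverse glues the root value \<open>k\<close> onto a tuple of subtree functions. The
  sets \<open>S i\<close> let one bijection serve both kinds of count: \<open>UNIV\<close> when only
  the root value is fixed, a prescribed restriction when a whole ball is.\<close>

lemma bij_betw_subtrees:
  "bij_betw (\<lambda>f. \<lambda>i\<in>{..<d}. \<lambda>v. f (i # v))
     {f \<in> lip0 d (Suc n). f [] = k \<and> (\<forall>i<d. (\<lambda>v. f (i # v)) \<in> S i)}
     (\<Pi>\<^sub>E i\<in>{..<d}. {h \<in> lip0 d n. \<bar>h [] - k\<bar> \<le> 1 \<and> h \<in> S i})"
proof (rule bij_betw_byWitness[where f' =
      "\<lambda>h v. case v of [] \<Rightarrow> k | i # w \<Rightarrow> if i < d then h i w else 0"])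
  show "\<forall>f\<in>{f \<in> lip0 d (Suc n). f [] = k \<and> (\<forall>i<d. (\<lambda>v. f (i # v)) \<in> S i)}.
      (\<lambda>v. case v of [] \<Rightarrow> k | i # w \<Rightarrow>
        if i < d then (\<lambda>i\<in>{..<d}. \<lambda>v. f (i # v)) i w else 0) = f"
    by (auto simp: lip0_Suc_iff fun_eq_iff split: list.split)
  show "\<forall>h\<in>\<Pi>\<^sub>E i\<in>{..<d}. {h \<in> lip0 d n. \<bar>h [] - k\<bar> \<le> 1 \<and> h \<in> S i}.
      (\<lambda>i\<in>{..<d}. \<lambda>v. case i # v of [] \<Rightarrow> k | i # w \<Rightarrow> if i < d then h i w else 0) = h"
    by (auto simp: PiE_def extensional_def fun_eq_iff)
  show "(\<lambda>f. \<lambda>i\<in>{..<d}. \<lambda>v. f (i # v)) `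
      {f \<in> lip0 d (Suc n). f [] = k \<and> (\<forall>i<d. (\<lambda>v. f (i # v)) \<in> S i)}
      \<subseteq> (\<Pi>\<^sub>E i\<in>{..<d}. {h \<in> lip0 d n. \<bar>h [] - k\<bar> \<le> 1 \<and> h \<in> S i})"
    by (auto simp: lip0_Suc_iff)
  show "(\<lambda>h v. case v of [] \<Rightarrow> k | i # w \<Rightarrow> if i < d then h i w else 0) `
      (\<Pi>\<^sub>E i\<in>{..<d}. {h \<in> lip0 d n. \<bar>h [] - k\<bar> \<le> 1 \<and> h \<in> S i})
      \<subseteq> {f \<in> lip0 d (Suc n). f [] = k \<and> (\<forall>i<d. (\<lambda>v. f (i # v)) \<in> S i)}"
    by (auto simp: lip0_Suc_iff PiE_def Pi_def)
qed

lemma card_lip0_Suc: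
  "card {f \<in> lip0 d (Suc n). f [] = k \<and> (\<forall>i<d. (\<lambda>v. f (i # v)) \<in> S i)} =
     (\<Prod>i<d. card {h \<in> lip0 d n. \<bar>h [] - k\<bar> \<le> 1 \<and> h \<in> S i})"
  using bij_betw_same_card[OF bij_betw_subtrees] by (simp add: card_PiE)

lemma finite_lip0:
  assumes "0 < d"
  shows "finite (lip0 d n)"
proof (induction n)
  case 0
  then show ?case by (simp add: lip0_0)
next
  case (Suc n)
  have "finite {f \<in> lip0 d (Suc n). f [] = k}" for k
  proof -
    have "finite (\<Pi>\<^sub>E i\<in>{..<d}. {h \<in> lip0 d n. \<bar>h [] - k\<bar> \<le> 1 \<and> h \<in> UNIV})"
      by (intro finite_PiE) (use Suc in auto)
    then show ?thesis
      using bij_betw_finite[OF bij_betw_subtrees[of d n k "\<lambda>_. UNIV"]] by simp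
  qed
  then have "finite (\<Union>k\<in>{-int (Suc n)..int (Suc n)}. {f \<in> lip0 d (Suc n). f [] = k})"
    by blast
  moreover have "lip0 d (Suc n) \<subseteq>
      (\<Union>k\<in>{-int (Suc n)..int (Suc n)}. {f \<in> lip0 d (Suc n). f [] = k})"
    using lip0_root_bound[OF assms, of _ "Suc n"] by (fastforce simp: abs_le_iff)
  ultimately show ?case by (rule rev_finite_subset)
qed

lemma zero_in_lip0: "(\<lambda>_. 0) \<in> lip0 d n"
  by (simp add: lip0_def)

text \<open>This is \<open>Z\<^sub>n(k)\<close>, real-valued so that ratios can be formed.\<close>

definition root_count :: "nat \<Rightarrow> nat \<Rightarrow> int \<Rightarrow> real" where
  "root_count d n k = real (card {f \<in> lip0 d n. f [] = k})"

definition ball_count :: "nat \<Rightarrow> nat \<Rightarrow> nat \<Rightarrow> (nat list \<Rightarrow> int) \<Rightarrow> real" where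
  "ball_count d n r g = real (card {f \<in> lip0 d n. restrict_ball d r f = g})"

lemma root_count_0: "root_count d 0 k = (if k = 0 then 1 else 0)"
proof -
  have "{f \<in> lip0 d 0. f [] = k} = (if k = 0 then {\<lambda>_. 0} else {})"
    by (auto simp: lip0_0)
  then show ?thesis by (simp add: root_count_def)
qed

lemma root_count_Suc:
  assumes "0 < d"
  shows "root_count d (Suc n) k =
    (root_count d n (k - 1) + root_count d n k + root_count d n (k + 1)) ^ d"
proof -
  have "{h \<in> lip0 d n. \<bar>h [] - k\<bar> \<le> 1} =
    {h \<in> lip0 d n. h [] = k - 1} \<union> ({h \<in> lip0 d n. h [] = k} \<union> {h \<in> lip0 d n. h [] = k + 1})"
    by auto
  then have "real (card {h \<in> lip0 d n. \<bar>h [] - k\<bar> \<le> 1}) =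
      root_count d n (k - 1) + (root_count d n k + root_count d n (k + 1))"
    using finite_lip0[OF assms, of n]
    by (subst (asm) fun_cong[OF refl, of _ card], simp add: root_count_def)
       (subst card_Un_disjoint, auto, subst card_Un_disjoint, auto)
  then show ?thesis
    using card_lip0_Suc[of d n k "\<lambda>_. UNIV"] by (simp add: root_count_def add.assoc)
qed

lemma ball_count_0:
  "ball_count d n 0 g = (if \<forall>v. v \<noteq> [] \<longrightarrow> g v = 0 then root_count d n (g []) else 0)"
proof -
  have eq: "restrict_ball d 0 f = g \<longleftrightarrow> f [] = g [] \<and> (\<forall>v. v \<noteq> [] \<longrightarrow> g v = 0)" for f
    by (auto simp: restrict_ball_0 fun_eq_iff)
  show ?thesis
  proof (cases "\<forall>v. v \<noteq> [] \<longrightarrow> g v = 0")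
    case True
    then have "{f \<in> lip0 d n. restrict_ball d 0 f = g} = {f \<in> lip0 d n. f [] = g []}"
      using eq by blast
    with True show ?thesis by (simp add: ball_count_def root_count_def)
  next
    case False
    then have "{f \<in> lip0 d n. restrict_ball d 0 f = g} = {}"
      using eq by blast
    then have "ball_count d n 0 g = 0" by (simp only: ball_count_def card.empty of_nat_0)
    with False show ?thesis by (simp only: if_False)
  qed
qed

text \<open>A prescribed ball fixes the values at the children of the root. The Lipschitz condition
  there becomes a condition on \<open>g\<close> alone, and the \<open>d\<close> subtrees contribute
  independent factors.\<close>

lemma ball_count_Suc:
  "ball_count d (Suc n) (Suc r) g =
    (if (\<forall>i v. d \<le> i \<longrightarrow> g (i # v) = 0) \<and> (\<forall>i<d. \<bar>g [i] - g []\<bar> \<le> 1)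
     then \<Prod>i<d. ball_count d n r (\<lambda>v. g (i # v)) else 0)"
proof (cases "\<forall>i v. d \<le> i \<longrightarrow> g (i # v) = 0")
  case True
  define S where "S i = {h. restrict_ball d r h = (\<lambda>v. g (i # v))}" for i
  have "{h \<in> lip0 d n. \<bar>h [] - g []\<bar> \<le> 1 \<and> h \<in> S i} =
    (if \<bar>g [i] - g []\<bar> \<le> 1 then {h \<in> lip0 d n. restrict_ball d r h = (\<lambda>v. g (i # v))} else {})" for i
  proof -
    have "h [] = g [i]" if "h \<in> S i" for h
      using that restrict_ball_Nil[of d r h] unfolding S_def by simp
    then show ?thesis by (auto simp: S_def)
  qed
  then have "real (\<Prod>i<d. card {h \<in> lip0 d n. \<bar>h [] - g []\<bar> \<le> 1 \<and> h \<in> S i}) =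
      (\<Prod>i<d. if \<bar>g [i] - g []\<bar> \<le> 1 then ball_count d n r (\<lambda>v. g (i # v)) else 0)"
    unfolding of_nat_prod by (intro prod.cong) (auto simp: ball_count_def)
  moreover have "{f \<in> lip0 d (Suc n). restrict_ball d (Suc r) f = g} =
      {f \<in> lip0 d (Suc n). f [] = g [] \<and> (\<forall>i<d. (\<lambda>v. f (i # v)) \<in> S i)}"
    using True by (auto simp: restrict_ball_Suc_eq_iff S_def)
  ultimately have "ball_count d (Suc n) (Suc r) g =
      (\<Prod>i<d. if \<bar>g [i] - g []\<bar> \<le> 1 then ball_count d n r (\<lambda>v. g (i # v)) else 0)"
    by (simp add: ball_count_def card_lip0_Suc)
  also have "\<dots> = (if \<forall>i<d. \<bar>g [i] - g []\<bar> \<le> 1 then \<Prod>i<d. ball_count d n r (\<lambda>v. g (i # v)) else 0)"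
    by auto
  finally show ?thesis using True by simp
next
  case False
  then have "{f \<in> lip0 d (Suc n). restrict_ball d (Suc r) f = g} = {}"
    unfolding restrict_ball_Suc_eq_iff by blast
  with False show ?thesis by (simp only: ball_count_def) simp
qed

lemma pmf_mu_local:
  assumes "0 < d"
  shows "pmf (mu_local d n r) g = ball_count d n r g / real (card (lip0 d n))"
proof -
  have "lip0 d n \<noteq> {}" using zero_in_lip0 by blast
  moreover have "lip0 d n \<inter> restrict_ball d r -` {g} = {f \<in> lip0 d n. restrict_ball d r f = g}"
    by auto
  ultimately show ?thesis
    using finite_lip0[OF assms]
    by (simp add: mu_local_def pmf_map measure_pmf_of_set ball_count_def)
qed

lemma card_lip0_eq_sum:
  assumes "0 < d"
  shows "real (card (lip0 d n)) = (\<Sum>k\<in>{-int n..int n}. root_count d n k)"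
proof -
  have "lip0 d n = (\<Union>k\<in>{-int n..int n}. {f \<in> lip0 d n. f [] = k})"
    using lip0_root_bound[OF assms, of _ n] by (fastforce simp: abs_le_iff)
  then have "card (lip0 d n) = card (\<Union>k\<in>{-int n..int n}. {f \<in> lip0 d n. f [] = k})"
    by simp
  also have "\<dots> = (\<Sum>k\<in>{-int n..int n}. card {f \<in> lip0 d n. f [] = k})"
    by (intro card_UN_disjoint) (use finite_lip0[OF assms] in auto)
  finally show ?thesis by (simp add: root_count_def)
qed

section \<open>The profile recursion\<close>

text \<open>The new entry is the sum of the three counts around \<open>k\<close> divided by the sum
  of the three around 0, both in units of the count at 0. Symmetry of the counts gives the
  denominator and makes indices \<open>k \<ge> 0\<close> sufficient.\<close>

definition profile_step :: "nat \<Rightarrow> (nat \<Rightarrow> real) \<Rightarrow> nat \<Rightarrow> real" where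
  "profile_step d p k =
    (if k = 0 then 1 else (p (k - 1) ^ d + p k ^ d + p (k + 1) ^ d) / (1 + 2 * p 1 ^ d))"

text \<open>For \<open>d > 0\<close>, depth 1 has one function for each root value -1, 0, 1 and none
  for any other. So the start is depth 1, and \<open>profile d n\<close> describes depth
  \<open>n + 1\<close>.\<close>

primrec profile :: "nat \<Rightarrow> nat \<Rightarrow> nat \<Rightarrow> real" where
  "profile d 0 = (\<lambda>k. if k \<le> 1 then 1 else 0)"
| "profile d (Suc n) = profile_step d (profile d n)"

lemma root_count_uminus:
  assumes "0 < d"
  shows "root_count d n (- k) = root_count d n k"
proof (induction n arbitrary: k)
  case (Suc n)
  have "root_count d n (- k - 1) = root_count d n (k + 1)"
    "root_count d n (- k + 1) = root_count d n (k - 1)"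
    using Suc[of "k + 1"] Suc[of "k - 1"] by simp_all
  with Suc[of k] show ?case by (simp add: root_count_Suc[OF assms] algebra_simps)
qed (simp add: root_count_0)

lemma root_count_nonneg [simp]: "0 \<le> root_count d n k"
  by (simp add: root_count_def)

text \<open>Halving can only start at index 1, because at depth 1 the counts at 0 and 1 agree. Both
  claims go through one induction: halving from index 1 to 2 at the next depth needs the
  monotonicity from 0 to 1.\<close>

lemma root_count_decay:
  assumes "2 \<le> d"
  shows "root_count d n 1 \<le> root_count d n 0 \<and>
    (\<forall>k::nat. root_count d n (int k + 2) \<le> root_count d n (int k + 1) / 2)"
proof (induction n)
  case (Suc n)
  let ?Z = "root_count d n"
  have d: "0 < d" using assms by simp
  have top: "?Z 1 \<le> ?Z 0" and half: "?Z (int k + 2) \<le> ?Z (int k + 1) / 2" for k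
    using Suc by auto
  have "?Z (-1) = ?Z 1" using root_count_uminus[OF d, of n 1] by simp
  moreover have "?Z 2 \<le> ?Z 1"
    using half[of 0] root_count_nonneg[of d n 1] unfolding of_nat_0 add_0_left by linarith
  ultimately have "(?Z 0 + ?Z 1 + ?Z 2) ^ d \<le> (?Z (-1) + ?Z 0 + ?Z 1) ^ d"
    by (intro power_mono) auto
  then have one: "root_count d (Suc n) 1 \<le> root_count d (Suc n) 0"
    by (simp add: root_count_Suc[OF d])
  have "root_count d (Suc n) (int k + 2) \<le> root_count d (Suc n) (int k + 1) / 2" for k
  proof -
    have le: "?Z (int k + 1) \<le> ?Z (int k)"
    proof (cases k)
      case 0
      then show ?thesis using top by simp
    next
      case (Suc m)
      then show ?thesis
        using half[of m] root_count_nonneg[of d n "int m + 1"]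
        by (subst (1 2) Suc) (simp del: root_count_nonneg add: add.commute)
    qed
    have next3: "?Z (int k + 3) \<le> ?Z (int k + 2) / 2"
      using half[of "Suc k"] by (simp add: add.commute)
    \<comment> \<open>The extreme case has proportions 1 : 1 : 1/2 : 1/4, where the two sums have
      ratio (7/4) / (5/2) = 7/10. Since 49/100 < 1/2, the exponent 2 already restores the
      halving.\<close>
    have "(?Z (int k + 1) + ?Z (int k + 2) + ?Z (int k + 3)) ^ d
        \<le> (7/10 * (?Z (int k) + ?Z (int k + 1) + ?Z (int k + 2))) ^ d"
      using le half[of k] next3 by (intro power_mono) auto
    also have "\<dots> = (7/10) ^ d * (?Z (int k) + ?Z (int k + 1) + ?Z (int k + 2)) ^ d"
      by (rule power_mult_distrib)
    also have "\<dots> \<le> 1/2 * (?Z (int k) + ?Z (int k + 1) + ?Z (int k + 2)) ^ d"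
    proof (rule mult_right_mono)
      have "(7/10::real) ^ d \<le> (7/10) ^ 2" using assms by (intro power_decreasing) auto
      also have "\<dots> \<le> 1/2" by (simp add: power2_eq_square)
      finally show "(7/10::real) ^ d \<le> 1/2" .
    qed simp
    finally show ?thesis by (simp add: root_count_Suc[OF d] add.commute add.left_commute)
  qed
  with one show ?case by blast
qed (simp add: root_count_0)

lemma root_count_pos:
  assumes "2 \<le> d"
  shows "0 < root_count d n 0"
proof (induction n)
  case (Suc n)
  have "0 < root_count d n (-1) + root_count d n 0 + root_count d n 1"
    using Suc by (intro add_nonneg_pos add_pos_nonneg) auto
  then show ?case using assms by (simp add: root_count_Suc)
qed (simp add: root_count_0)

text \<open>The bound is uniform in \<open>n\<close>; it is the majorant for exchanging limit and
  sum, and the source of tightness.\<close>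

lemma root_count_geometric:
  assumes "2 \<le> d"
  shows "root_count d n (int k + 1) \<le> root_count d n 0 * (1/2) ^ k"
proof (induction k)
  case 0
  then show ?case using root_count_decay[OF assms] by simp
next
  case (Suc k)
  have "root_count d n (int k + 2) \<le> root_count d n (int k + 1) / 2"
    using root_count_decay[OF assms, of n] by blast
  also have "\<dots> \<le> root_count d n 0 * (1/2) ^ Suc k" using Suc by simp
  finally show ?case by (simp add: add.commute)
qed

lemma profile_at_0 [simp]: "profile d n 0 = 1"
  by (cases n) (simp_all add: profile_step_def)

text \<open>The three counts around 0 add up to the count at 0 times \<open>1 + 2 * p 1 ^ d\<close>,
  the denominator of the recursion. The sum around \<open>k\<close> is this quantity times the next
  profile entry, and \<open>d\<close>-th powers lead to the next depth.\<close>

lemma root_count_eq_profile: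
  assumes "2 \<le> d"
  shows "root_count d (Suc n) (int k) = root_count d (Suc n) 0 * profile d n k ^ d"
proof (induction n arbitrary: k)
  case 0
  show ?case using assms by (cases "k = 0"; cases "k = 1") (auto simp: root_count_Suc root_count_0)
next
  case (Suc n)
  let ?Z = "root_count d (Suc n)" and ?p = "profile d n"
  have d: "0 < d" using assms by simp
  show ?case
  proof (cases k)
    case (Suc m)
    have "?Z (-1) = ?Z 1" using root_count_uminus[OF d, of "Suc n" 1] by simp
    then have sum0: "?Z (-1) + ?Z 0 + ?Z 1 = ?Z 0 * (1 + 2 * ?p 1 ^ d)"
      using Suc.IH[of 1] by (simp add: algebra_simps)
    have "0 < ?Z 0 * (1 + 2 * ?p 1 ^ d)"
      using sum0 root_count_pos[OF assms, of "Suc n"] root_count_nonneg[of d "Suc n"]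
      by (metis add_nonneg_pos add_pos_nonneg)
    then have pos: "1 + 2 * ?p 1 ^ d \<noteq> 0" by auto
    have "?Z (int m) + ?Z (int (m + 1)) + ?Z (int (m + 2)) =
        ?Z 0 * (1 + 2 * ?p 1 ^ d) * profile d (Suc n) k"
      using pos unfolding Suc.IH Suc by (simp add: profile_step_def field_simps)
    then show ?thesis
      using sum0 Suc
      by (simp add: root_count_Suc[OF d, of "Suc n"] power_mult_distrib add.commute add.left_commute)
  next
    case 0
    then show ?thesis by (simp add: profile_step_def)
  qed
qed

section \<open>Contraction on an invariant box\<close>

lemma power_diff_bound:
  fixes u v :: real
  assumes "u \<in> {0..b}" "v \<in> {0..b}"
  shows "\<bar>u ^ d - v ^ d\<bar> \<le> real d * b ^ (d - 1) * \<bar>u - v\<bar>"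
proof -
  have "norm (u ^ d - v ^ d) \<le> real d * b ^ (d - 1) * norm (u - v)"
  proof (rule field_differentiable_bound[of "{0..b}" "\<lambda>z. z ^ d" "\<lambda>z. real d * z ^ (d - 1)"])
    show "((\<lambda>z. z ^ d) has_field_derivative real d * z ^ (d - 1)) (at z within {0..b})" for z :: real
      by (auto intro!: derivative_eq_intros)
    show "norm (real d * z ^ (d - 1)) \<le> real d * b ^ (d - 1)" if "z \<in> {0..b}" for z
      using that by (auto simp: abs_mult intro!: mult_left_mono power_mono)
  qed (use assms in auto)
  then show ?thesis by simp
qed

text \<open>Mean value theorem. The hypothesis says that \<open>\<kappa>\<close> bounds the slope of
  \<open>(1 + u ^ d) / (1 + 2 * u ^ d)\<close>, which is 1/2 plus half of the reciprocal treated
  here; hence the factor 2.\<close>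

lemma inverse_power_diff_bound:
  fixes u v \<kappa> :: real
  assumes bound: "\<And>z. z \<in> {2/3..1} \<Longrightarrow> real d * z ^ (d - 1) \<le> \<kappa> * (1 + 2 * z ^ d)\<^sup>2"
    and u: "u \<in> {2/3..1}" and v: "v \<in> {2/3..1}"
  shows "\<bar>1 / (1 + 2 * u ^ d) - 1 / (1 + 2 * v ^ d)\<bar> \<le> 2 * \<kappa> * \<bar>u - v\<bar>"
proof -
  have pos: "0 < 1 + 2 * z ^ d" if "z \<in> {2/3..1}" for z :: real
    using that by (intro add_pos_nonneg) auto
  have "norm (1 / (1 + 2 * u ^ d) - 1 / (1 + 2 * v ^ d)) \<le> 2 * \<kappa> * norm (u - v)"
  proof (rule field_differentiable_bound[of "{2/3..1}" "\<lambda>z. 1 / (1 + 2 * z ^ d)"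
        "\<lambda>z. - (2 * (real d * z ^ (d - 1))) / (1 + 2 * z ^ d)\<^sup>2"])
    show "((\<lambda>z. 1 / (1 + 2 * z ^ d)) has_field_derivative
        - (2 * (real d * z ^ (d - 1))) / (1 + 2 * z ^ d)\<^sup>2) (at z within {2/3..1})"
      if "z \<in> {2/3..1}" for z
      using pos[OF that] by (auto intro!: derivative_eq_intros simp: power2_eq_square)
    show "norm (- (2 * (real d * z ^ (d - 1))) / (1 + 2 * z ^ d)\<^sup>2) \<le> 2 * \<kappa>"
      if "z \<in> {2/3..1}" for z
      using bound[OF that] pos[OF that] that by (simp add: abs_mult divide_le_eq)
  qed (use u v in auto)
  then show ?thesis by simp
qed

text \<open>The lower end 2/3 is the value of \<open>(1 + x) / (1 + 2 * x)\<close> at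
  \<open>x = 1\<close>.\<close>

definition in_box :: "real \<Rightarrow> real \<Rightarrow> (nat \<Rightarrow> real) \<Rightarrow> bool" where
  "in_box b c p \<longleftrightarrow> p 0 = 1 \<and> p 1 \<in> {2/3..1} \<and> p 2 \<in> {0..b} \<and> (\<forall>k\<ge>3. p k \<in> {0..c})"

text \<open>The last two conditions keep entry 2 below \<open>b\<close> and the later entries below
  \<open>c\<close>. The worst case for entry 2 is \<open>p 1 = 1\<close>, with denominator 3; for
  the later entries it is \<open>p 1 = 2/3\<close>, with the smallest denominator.\<close>

locale profile_box =
  fixes d :: nat and b c :: real
  assumes d_ge_2: "2 \<le> d" and c_nonneg: "0 \<le> c" and c_le_b: "c \<le> b" and b_le: "b \<le> 1/2"
    and box_2: "1 + b ^ d + c ^ d \<le> 3 * b"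
    and box_3: "b ^ d + 2 * c ^ d \<le> c * (1 + 2 * (2/3) ^ d)"
begin

lemma box_powers:
  assumes "in_box b c p"
  shows "p 1 ^ d \<in> {(2/3) ^ d..1}" "p 2 ^ d \<in> {0..b ^ d}"
    "3 \<le> k \<Longrightarrow> p k ^ d \<in> {0..c ^ d}" "2 \<le> k \<Longrightarrow> p k ^ d \<in> {0..b ^ d}"
    "p 2 ^ d \<le> p 1 ^ d"
proof -
  show "p 1 ^ d \<in> {(2/3) ^ d..1}"
    using assms by (auto simp: in_box_def intro!: power_mono power_le_one)
  show two: "p 2 ^ d \<in> {0..b ^ d}"
    using assms by (auto simp: in_box_def intro!: power_mono)
  show three: "3 \<le> k \<Longrightarrow> p k ^ d \<in> {0..c ^ d}" for k
    using assms by (auto simp: in_box_def intro!: power_mono)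
  have "c ^ d \<le> b ^ d" using c_le_b c_nonneg by (rule power_mono)
  then show "2 \<le> k \<Longrightarrow> p k ^ d \<in> {0..b ^ d}"
    using two three[of k] by (cases "k = 2") auto
  have "p 2 \<le> p 1" "0 \<le> p 2" using assms b_le by (auto simp: in_box_def)
  then show "p 2 ^ d \<le> p 1 ^ d" by (rule power_mono)
qed

lemma in_box_step:
  assumes p: "in_box b c p"
  shows "in_box b c (profile_step d p)"
proof -
  define x where "x = p 1 ^ d"
  have x: "(2/3) ^ d \<le> x" "x \<le> 1" "0 \<le> x"
    using box_powers(1)[OF p] unfolding x_def
    by (auto intro: order_trans[of 0 "(2/3) ^ d"])
  have x2: "0 \<le> p 2 ^ d" "p 2 ^ d \<le> b ^ d" "p 2 ^ d \<le> x"
    using box_powers[OF p] by (auto simp: x_def)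
  have x3: "0 \<le> p k ^ d" "p k ^ d \<le> c ^ d" if "3 \<le> k" for k
    using box_powers(3)[OF p that] by auto
  have tail: "b ^ d + c ^ d \<le> 1/2" using box_2 b_le by simp
  have "profile_step d p 1 = (1 + x + p 2 ^ d) / (1 + 2 * x)"
    using p by (simp add: profile_step_def in_box_def x_def numeral_2_eq_2)
  \<comment> \<open>The upper bound rests on \<open>p 2 ^ d \<le> p 1 ^ d\<close>, the lower one on
    \<open>p 1 ^ d \<le> 1\<close>.\<close>
  then have "profile_step d p 1 \<in> {2/3..1}"
    using x x2 by (simp add: divide_le_eq le_divide_eq)
  moreover have "profile_step d p 2 \<in> {0..b}"
  proof -
    define w where "w = p 2 ^ d + p 3 ^ d"
    have w: "0 \<le> w" "w \<le> b ^ d + c ^ d" using x2 x3[of 3] by (auto simp: w_def)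
    \<comment> \<open>For \<open>w \<le> 1/2\<close> the quotient
      \<open>(x + w) / (1 + 2 * x)\<close> increases in \<open>x\<close>, so its maximum
      \<open>(1 + w) / 3\<close> is at \<open>x = 1\<close>.\<close>
    have "0 \<le> (1 - x) * (1 - 2 * w)" using x w tail by (intro mult_nonneg_nonneg) auto
    then have "3 * (x + w) \<le> (1 + w) * (1 + 2 * x)" by (simp add: algebra_simps)
    also have "\<dots> \<le> (3 * b) * (1 + 2 * x)"
      using w box_2 x by (intro mult_right_mono) auto
    finally have "x + w \<le> b * (1 + 2 * x)" by simp
    then show ?thesis
      using x w by (auto simp: profile_step_def x_def w_def field_simps numeral_3_eq_3 numeral_2_eq_2)
  qed
  moreover have "profile_step d p k \<in> {0..c}" if k: "3 \<le> k" for k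
  proof -
    define s where "s = p (k - 1) ^ d + p k ^ d + p (k + 1) ^ d"
    have "p (k - 1) ^ d \<in> {0..b ^ d}" using box_powers(4)[OF p, of "k - 1"] k by simp
    then have s: "0 \<le> s" "s \<le> b ^ d + 2 * c ^ d"
      using x3[of k] x3[of "k + 1"] k by (auto simp: s_def)
    note s(2)
    also have "b ^ d + 2 * c ^ d \<le> c * (1 + 2 * (2/3) ^ d)" by (rule box_3)
    also have "\<dots> \<le> c * (1 + 2 * x)" using x c_nonneg by (intro mult_left_mono) auto
    finally show ?thesis
      using x s k by (auto simp: profile_step_def x_def s_def divide_le_eq)
  qed
  ultimately show ?thesis by (simp add: in_box_def profile_step_def)
qed

lemma in_box_profile: "in_box b c (profile d n)"
proof (induction n)
  case 0
  then show ?case using c_nonneg c_le_b by (auto simp: in_box_def)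
next
  case (Suc n)
  then show ?case by (simp add: in_box_step)
qed

end

text \<open>The rows bound the Lipschitz constants, in the supremum norm, of entry 1, entry 2 and
  the later entries of the step. In each, the term with \<open>\<kappa>\<close> comes from the
  denominator and the quotient from the entries with index at least 2.\<close>

locale contracting_box = profile_box +
  fixes \<kappa> K :: real
  assumes K_nonneg: "0 \<le> K" and K_less_1: "K < 1"
    and slope: "\<And>z. z \<in> {2/3..1} \<Longrightarrow> real d * z ^ (d - 1) \<le> \<kappa> * (1 + 2 * z ^ d)\<^sup>2"
    and row_1: "(1 + 2 * b ^ d) * \<kappa> + real d * b ^ (d - 1) / (1 + 2 * (2/3) ^ d) \<le> K"
    and row_2: "\<kappa> + real d * (b ^ (d - 1) + c ^ (d - 1)) / (1 + 2 * (2/3) ^ d) \<le> K"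
    and row_3: "2 * (b ^ d + 2 * c ^ d) * \<kappa> +
      real d * (b ^ (d - 1) + 2 * c ^ (d - 1)) / (1 + 2 * (2/3) ^ d) \<le> K"
begin

lemma slope_nonneg: "0 \<le> \<kappa>"
proof -
  have "0 \<le> \<kappa> * 3\<^sup>2" using slope[of 1] by simp
  then show ?thesis by simp
qed

text \<open>Every entry \<open>j \<ge> 1\<close> of the step differs by a constant from a quotient
  \<open>w / (1 + 2 p(1)\<^sup>d)\<close>. For \<open>j \<le> 2\<close> the constant \<open>1/2\<close> makes \<open>w\<close> depend on
  the entries \<open>p(k)\<close> with \<open>k \<ge> 2\<close> only; \<open>\<kappa>\<close> controls the change of the
  denominator and \<open>\<epsilon>\<close> that of \<open>w\<close>.\<close>
lemma quotient_diff_bound: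
  assumes p: "in_box b c p" and q: "in_box b c q" and D: "\<bar>p 1 - q 1\<bar> \<le> D"
    and w: "\<bar>w\<bar> \<le> W" and e: "\<bar>w - w'\<bar> \<le> \<epsilon> * D"
  shows "\<bar>w / (1 + 2 * p 1 ^ d) - w' / (1 + 2 * q 1 ^ d)\<bar>
    \<le> (2 * W * \<kappa> + \<epsilon> / (1 + 2 * (2/3) ^ d)) * D"
proof -
  let ?u = "1 + 2 * p 1 ^ d" and ?v = "1 + 2 * q 1 ^ d" and ?m = "1 + 2 * (2/3::real) ^ d"
  have m: "0 < ?m" by (intro add_pos_nonneg) auto
  have v: "?m \<le> ?v" using box_powers(1)[OF q] by auto
  have "\<bar>1 / ?u - 1 / ?v\<bar> \<le> 2 * \<kappa> * \<bar>p 1 - q 1\<bar>"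
    using p q by (intro inverse_power_diff_bound slope) (auto simp: in_box_def)
  also have "\<dots> \<le> 2 * \<kappa> * D" using D slope_nonneg by (intro mult_left_mono) auto
  finally have "\<bar>w\<bar> * \<bar>1 / ?u - 1 / ?v\<bar> \<le> W * (2 * \<kappa> * D)"
    using w by (intro mult_mono) auto
  moreover have "\<bar>w - w'\<bar> / ?v \<le> \<epsilon> * D / ?m"
    using e v m by (intro frac_le) auto
  moreover have "w / ?u - w' / ?v = w * (1 / ?u - 1 / ?v) + (w - w') / ?v"
    by (simp add: field_simps diff_divide_distrib)
  then have "\<bar>w / ?u - w' / ?v\<bar> \<le> \<bar>w\<bar> * \<bar>1 / ?u - 1 / ?v\<bar> + \<bar>w - w'\<bar> / ?v"
    using v m abs_triangle_ineq[of "w * (1 / ?u - 1 / ?v)" "(w - w') / ?v"]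
    by (simp add: abs_mult)
  ultimately show ?thesis by (simp add: algebra_simps)
qed

text \<open>Entry 0 is constant. For entries 1, 2 and beyond, \<open>r1\<close>, \<open>r2\<close>,
  \<open>r3\<close> restate the row conditions in the shape that \<open>quot\<close>
  delivers.\<close>

lemma step_contraction:
  assumes p: "in_box b c p" and q: "in_box b c q" and D: "\<And>k. \<bar>p k - q k\<bar> \<le> D"
  shows "\<bar>profile_step d p k - profile_step d q k\<bar> \<le> K * D"
proof -
  let ?u = "1 + 2 * p 1 ^ d" and ?v = "1 + 2 * q 1 ^ d"
  define m where "m = 1 + 2 * (2/3::real) ^ d"
  let ?\<beta> = "real d * b ^ (d - 1)" and ?\<gamma> = "real d * c ^ (d - 1)"
  have D0: "0 \<le> D" using D[of 0] by simp
  have u: "0 < ?u" and v: "0 < ?v"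
    using p q by (auto simp: in_box_def intro!: add_pos_nonneg)
  have lip: "\<bar>p k ^ d - q k ^ d\<bar> \<le> real d * a ^ (d - 1) * D"
    if "p k \<in> {0..a}" "q k \<in> {0..a}" for k a
  proof -
    have "\<bar>p k ^ d - q k ^ d\<bar> \<le> real d * a ^ (d - 1) * \<bar>p k - q k\<bar>"
      by (rule power_diff_bound[OF that])
    also have "\<dots> \<le> real d * a ^ (d - 1) * D" using D that by (intro mult_left_mono) auto
    finally show ?thesis .
  qed
  have in_b: "p k \<in> {0..b}" "q k \<in> {0..b}" if "2 \<le> k" for k
  proof -
    have "r k \<in> {0..b}" if "in_box b c r" for r
    proof (cases "k = 2")
      case False
      with \<open>2 \<le> k\<close> have "3 \<le> k" by simp
      with that have "r k \<in> {0..c}" by (simp add: in_box_def)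
      with c_le_b show ?thesis by simp
    qed (use that in \<open>simp add: in_box_def\<close>)
    with p q show "p k \<in> {0..b}" "q k \<in> {0..b}" by blast+
  qed
  have in_c: "p k \<in> {0..c}" "q k \<in> {0..c}" if "3 \<le> k" for k
    using p q that by (auto simp: in_box_def)
  have lip_b: "\<bar>p k ^ d - q k ^ d\<bar> \<le> ?\<beta> * D" if "2 \<le> k" for k
    using in_b[OF that] by (rule lip)
  have lip_c: "\<bar>p k ^ d - q k ^ d\<bar> \<le> ?\<gamma> * D" if "3 \<le> k" for k
    using in_c[OF that] by (rule lip)
  have p0: "p 0 = 1" and q0: "q 0 = 1" using p q by (simp_all add: in_box_def)
  note quot = quotient_diff_bound[OF p q D[of 1], folded m_def]
  have eq1: "profile_step d r 1 = 1/2 + (1/2 + r 2 ^ d) / (1 + 2 * r 1 ^ d)"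
    if "0 < 1 + 2 * r 1 ^ d" "r 0 = 1" for r
    using that by (simp add: profile_step_def field_simps numeral_2_eq_2)
  have eq2: "profile_step d r 2 = 1/2 + (r 2 ^ d + r 3 ^ d - 1/2) / (1 + 2 * r 1 ^ d)"
    if "0 < 1 + 2 * r 1 ^ d" for r
    using that by (simp add: profile_step_def field_simps numeral_2_eq_2 numeral_3_eq_3)
  have r1: "2 * (1/2 + b ^ d) * \<kappa> + ?\<beta> / m \<le> K"
    using row_1 by (simp add: m_def[symmetric] algebra_simps)
  have r2: "2 * (1/2) * \<kappa> + (?\<beta> + ?\<gamma>) / m \<le> K"
    using row_2 by (simp add: m_def[symmetric] algebra_simps)
  have r3: "2 * (b ^ d + 2 * c ^ d) * \<kappa> + (?\<beta> + 2 * ?\<gamma>) / m \<le> K"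
    using row_3 by (simp add: m_def[symmetric] algebra_simps)
  consider "k = 0" | "k = 1" | "k = 2" | "3 \<le> k" by linarith
  then show ?thesis
  proof cases
    case 1
    then show ?thesis using D0 K_nonneg by (simp add: profile_step_def)
  next
    case 2
    have "\<bar>(1/2 + p 2 ^ d) / ?u - (1/2 + q 2 ^ d) / ?v\<bar>
        \<le> (2 * (1/2 + b ^ d) * \<kappa> + ?\<beta> / m) * D"
    proof (rule quot)
      show "\<bar>1/2 + p 2 ^ d\<bar> \<le> 1/2 + b ^ d"
        using box_powers(2)[OF p] by simp
      show "\<bar>1/2 + p 2 ^ d - (1/2 + q 2 ^ d)\<bar> \<le> ?\<beta> * D"
        using lip_b[of 2] by simp
    qed
    also have "\<dots> \<le> K * D" using r1 D0 by (rule mult_right_mono)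
    finally show ?thesis
      by (simp only: 2 eq1[of p, OF u p0] eq1[of q, OF v q0] add_diff_cancel_left)
  next
    case 3
    have "\<bar>(p 2 ^ d + p 3 ^ d - 1/2) / ?u - (q 2 ^ d + q 3 ^ d - 1/2) / ?v\<bar>
        \<le> (2 * (1/2) * \<kappa> + (?\<beta> + ?\<gamma>) / m) * D"
    proof (rule quot)
      \<comment> \<open>The two powers add up to a number between 0 and
        \<open>3 * b - 1 \<le> 1/2\<close>.\<close>
      show "\<bar>p 2 ^ d + p 3 ^ d - 1/2\<bar> \<le> 1/2"
        using box_powers(2)[OF p] box_powers(3)[OF p order_refl] box_2 b_le
        unfolding atLeastAtMost_iff by linarith
      have "\<bar>p 2 ^ d - q 2 ^ d\<bar> \<le> ?\<beta> * D" "\<bar>p 3 ^ d - q 3 ^ d\<bar> \<le> ?\<gamma> * D"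
        by (simp_all only: lip_b lip_c order_refl)
      then show "\<bar>p 2 ^ d + p 3 ^ d - 1/2 - (q 2 ^ d + q 3 ^ d - 1/2)\<bar> \<le> (?\<beta> + ?\<gamma>) * D"
        unfolding distrib_right by linarith
    qed
    also have "\<dots> \<le> K * D" using r2 D0 by (rule mult_right_mono)
    finally show ?thesis
      by (simp only: 3 eq2[of p, OF u] eq2[of q, OF v] add_diff_cancel_left)
  next
    case 4
    let ?s = "\<lambda>r. r (k - 1) ^ d + r k ^ d + r (k + 1) ^ d :: real"
    have k: "2 \<le> k - 1" "3 \<le> k + 1" using 4 by simp_all
    have "\<bar>?s p / ?u - ?s q / ?v\<bar>
        \<le> (2 * (b ^ d + 2 * c ^ d) * \<kappa> + (?\<beta> + 2 * ?\<gamma>) / m) * D"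
    proof (rule quot)
      show "\<bar>?s p\<bar> \<le> b ^ d + 2 * c ^ d"
        using box_powers(4)[OF p k(1)] box_powers(3)[OF p 4] box_powers(3)[OF p k(2)]
        unfolding atLeastAtMost_iff by linarith
      have "(?\<beta> + 2 * ?\<gamma>) * D = ?\<beta> * D + ?\<gamma> * D + ?\<gamma> * D"
        by (simp only: distrib_right mult_2)
      then show "\<bar>?s p - ?s q\<bar> \<le> (?\<beta> + 2 * ?\<gamma>) * D"
        using lip_b[OF k(1)] lip_c[OF 4] lip_c[OF k(2)] by linarith
    qed
    also have "\<dots> \<le> K * D" using r3 D0 by (rule mult_right_mono)
    finally show ?thesis using 4 by (simp add: profile_step_def)
  qed
qed

text \<open>All entries lie in the unit interval, which starts the induction; each further step
  gains a factor \<open>K\<close>, uniformly in \<open>k\<close>.\<close>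

lemma profile_increment: "\<bar>profile d (Suc n) k - profile d n k\<bar> \<le> K ^ n"
proof (induction n arbitrary: k)
  case 0
  have "profile d n k \<in> {0..1}" for n
  proof -
    consider "k = 0" | "k = 1" | "k = 2" | "3 \<le> k" by linarith
    then show ?thesis
      by cases (use in_box_profile[of n] c_le_b b_le in \<open>auto simp: in_box_def\<close>)
  qed
  from this[of "Suc 0"] this[of 0] show ?case
    by (simp del: profile.simps add: abs_le_iff)
next
  case (Suc n)
  show ?case
    using step_contraction[OF in_box_profile in_box_profile Suc] by simp
qed

lemma convergent_profile: "convergent (\<lambda>n. profile d n k)"
proof -
  have "summable (\<lambda>n. K ^ n)" using K_nonneg K_less_1 by (simp add: summable_geometric)
  then have "summable (\<lambda>n. profile d (Suc n) k - profile d n k)"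
    by (rule summable_comparison_test') (use profile_increment in simp)
  moreover have "(\<lambda>n. \<Sum>i<n. profile d (Suc i) k - profile d i k) =
      (\<lambda>n. profile d n k - profile d 0 k)"
    by (rule ext) (rule sum_lessThan_telescope)
  ultimately have "convergent (\<lambda>n. profile d n k - profile d 0 k)"
    unfolding summable_iff_convergent by (rule back_subst)
  then show ?thesis unfolding convergent_diff_const_right_iff .
qed

end

section \<open>Numerical conditions for degrees 2 to 7\<close>

lemma weighted_am_gm_power:
  fixes z a :: real
  assumes "0 \<le> z" "0 \<le> a"
  shows "real (Suc n) * z ^ n * a \<le> real n * z ^ Suc n + a ^ Suc n"
proof (induction n)
  case (Suc n)
  \<comment> \<open>Both factors have the same sign. Adding this product to \<open>z\<close> times
    the induction hypothesis gives the next case.\<close>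
  have "0 \<le> (z - a) * (z ^ Suc n - a ^ Suc n)"
  proof (cases "a \<le> z")
    case True
    then show ?thesis using assms by (intro mult_nonneg_nonneg) (auto intro!: mult_mono power_mono)
  next
    case False
    then show ?thesis using assms by (intro mult_nonpos_nonpos) (auto intro!: mult_mono power_mono)
  qed
  moreover have "z * (real (Suc n) * z ^ n * a) \<le> z * (real n * z ^ Suc n + a ^ Suc n)"
    using Suc assms by (intro mult_left_mono) auto
  ultimately show ?case by (simp add: algebra_simps)
qed simp

text \<open>With \<open>x = z\<^sup>d\<close> the AM-GM inequality bounds the left-hand side by the line
  \<open>((d - 1) x + a\<^sup>d) / a\<close>; the hypothesis says that the discriminant of
  \<open>\<kappa> (1 + 2 x)\<^sup>2\<close> minus this line is not positive.\<close>
lemma slope_by_discriminant: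
  fixes z a \<kappa> :: real
  assumes "0 < d" "0 \<le> z" "0 < a" "0 < \<kappa>"
    and disc: "(real (d - 1) / a - 4 * \<kappa>)\<^sup>2 \<le> 16 * \<kappa> * (\<kappa> - a ^ (d - 1))"
  shows "real d * z ^ (d - 1) \<le> \<kappa> * (1 + 2 * z ^ d)\<^sup>2"
proof -
  obtain n where n: "d = Suc n" using assms(1) by (cases d) auto
  define x where "x = z ^ d"
  define t where "t = real n / a - 4 * \<kappa>"
  have "real d * z ^ n * a \<le> real n * x + a ^ d"
    using weighted_am_gm_power[of z a n] assms by (simp add: n x_def)
  then have "real d * z ^ n \<le> (real n * x + a ^ d) / a"
    using assms by (simp add: le_divide_eq)
  also have "\<dots> = real n / a * x + a ^ n"
    using assms by (simp add: n add_divide_distrib)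
  also have "\<dots> = (t + 4 * \<kappa>) * x + a ^ n" by (simp add: t_def)
  also have "\<dots> \<le> \<kappa> * (1 + 2 * x)\<^sup>2"
  proof -
    \<comment> \<open>Completing the square: the desired difference times
      \<open>16 * \<kappa>\<close> is a square plus the slack in the hypothesis.\<close>
    have "0 \<le> (8 * \<kappa> * x - t)\<^sup>2 + (16 * \<kappa> * (\<kappa> - a ^ n) - t\<^sup>2)"
      using disc by (simp add: n t_def)
    also have "\<dots> = 16 * \<kappa> * (\<kappa> * (1 + 2 * x)\<^sup>2 - ((t + 4 * \<kappa>) * x + a ^ n))"
      by (simp add: power2_eq_square algebra_simps)
    finally show ?thesis using assms(4) by (simp add: zero_le_mult_iff)
  qed
  finally show ?thesis by (simp add: n x_def)
qed

text \<open>Powers of 35/100 and 5/100 decrease in the exponent, so 3 is the critical degree. The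
  same box also serves the oscillation argument for \<open>d \<ge> 8\<close>.\<close>

lemma profile_box_ge_3:
  assumes "3 \<le> d"
  shows "profile_box d (35/100) (5/100)"
proof
  have pow: "(35/100) ^ d \<le> (35/100::real) ^ 3" "(5/100) ^ d \<le> (5/100::real) ^ 3"
    using assms by (intro power_decreasing; simp)+
  show "2 \<le> d" using assms by simp
  show "1 + (35/100) ^ d + (5/100) ^ d \<le> 3 * (35/100::real)"
    using pow by (simp add: eval_nat_numeral)
  have "(35/100) ^ d + 2 * (5/100) ^ d \<le> 5/100 * (1::real)"
    using pow by (simp add: eval_nat_numeral)
  also have "\<dots> \<le> 5/100 * (1 + 2 * (2/3) ^ d)" by (intro mult_left_mono) auto
  finally show "(35/100) ^ d + 2 * (5/100) ^ d \<le> 5/100 * (1 + 2 * (2/3) ^ d :: real)" .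
qed auto

text \<open>Degree 2 needs a larger box, since \<open>1 + b ^ 2 \<le> 3 * b\<close> fails at
  \<open>b = 35/100\<close>. In this box a \<open>\<kappa>\<close> valid for all
  \<open>z \<ge> 0\<close> would violate \<open>row_1\<close>, so the slope is bounded on the
  interval from 2/3 only.\<close>

lemma contracting_box_2: "contracting_box 2 (42/100) (11/100) (375/1000) (97/100)"
proof
  fix z :: real assume z: "z \<in> {2/3..1}"
  have "0 \<le> z * (z - 2/3)" using z by (intro mult_nonneg_nonneg) auto
  \<comment> \<open>This is the tangent at 2/3, where the slope is largest on the interval.\<close>
  moreover have "1/9 + 8/3 * z \<le> 1 + 2 * z\<^sup>2"
    using zero_le_power2[of "z - 2/3"] by (simp add: power2_eq_square algebra_simps)
  then have "(1/9 + 8/3 * z)\<^sup>2 \<le> (1 + 2 * z\<^sup>2)\<^sup>2" using z by (intro power_mono) auto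
  ultimately show "real 2 * z ^ (2 - 1) \<le> 375/1000 * (1 + 2 * z\<^sup>2)\<^sup>2"
    by (simp add: power2_eq_square algebra_simps)
qed (simp_all add: power2_eq_square)

lemma contracting_box_by_discriminant:
  fixes a \<kappa> :: real
  assumes d: "3 \<le> d" and a: "0 < a" and \<kappa>: "0 < \<kappa>"
    and disc: "(real (d - 1) / a - 4 * \<kappa>)\<^sup>2 \<le> 16 * \<kappa> * (\<kappa> - a ^ (d - 1))"
    and rows: "(1 + 2 * (35/100) ^ d) * \<kappa> +
        real d * (35/100) ^ (d - 1) / (1 + 2 * (2/3) ^ d) \<le> 999/1000"
      "\<kappa> + real d * ((35/100) ^ (d - 1) + (5/100) ^ (d - 1)) / (1 + 2 * (2/3) ^ d) \<le> 999/1000"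
      "2 * ((35/100) ^ d + 2 * (5/100) ^ d) * \<kappa> +
        real d * ((35/100) ^ (d - 1) + 2 * (5/100) ^ (d - 1)) / (1 + 2 * (2/3) ^ d) \<le> 999/1000"
  shows "contracting_box d (35/100) (5/100) \<kappa> (999/1000)"
proof (intro contracting_box.intro contracting_box_axioms.intro profile_box_ge_3 d rows)
  show "real d * z ^ (d - 1) \<le> \<kappa> * (1 + 2 * z ^ d)\<^sup>2" if "z \<in> {2/3..1}" for z
  proof (rule slope_by_discriminant[OF _ _ a \<kappa> disc])
    show "0 < d" using d by simp
    show "0 \<le> z" using that by simp
  qed
qed simp_all

text \<open>Each \<open>a\<close> approximates the point where the slope
  \<open>d * z ^ (d - 1) / (1 + 2 * z ^ d)\<^sup>2\<close> peaks, given by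
  \<open>z ^ d = (d - 1) / (2 * (d + 1))\<close>; each \<open>\<kappa>\<close> is slightly above the
  peak value.\<close>

lemma contracting_box_ge_3:
  assumes "3 \<le> d" "d \<le> 7"
  shows "\<exists>\<kappa> K. contracting_box d (35/100) (5/100) \<kappa> K"
proof -
  have "contracting_box 3 (35/100) (5/100) (53/100) (999/1000)"
    by (rule contracting_box_by_discriminant[where a = "63/100"]) (simp_all add: power_divide)
  moreover have "contracting_box 4 (35/100) (5/100) (64/100) (999/1000)"
    by (rule contracting_box_by_discriminant[where a = "74/100"]) (simp_all add: power_divide)
  moreover have "contracting_box 5 (35/100) (5/100) (75/100) (999/1000)"
    by (rule contracting_box_by_discriminant[where a = "80/100"]) (simp_all add: power_divide)
  moreover have "contracting_box 6 (35/100) (5/100) (87/100) (999/1000)"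
    by (rule contracting_box_by_discriminant[where a = "84/100"]) (simp_all add: power_divide)
  \<comment> \<open>Here \<open>row_1\<close> evaluates to about 0.99899, so \<open>\<kappa>\<close>
    needs four digits.\<close>
  moreover have "contracting_box 7 (35/100) (5/100) (9862/10000) (999/1000)"
    by (rule contracting_box_by_discriminant[where a = "87/100"]) (simp_all add: power_divide)
  moreover have "d \<in> {3, 4, 5, 6, 7}" using assms by auto
  ultimately show ?thesis by blast
qed

lemma convergent_profile:
  assumes "2 \<le> d" "d \<le> 7"
  shows "convergent (\<lambda>n. profile d n k)"
proof (cases "d = 2")
  case True
  then show ?thesis using contracting_box.convergent_profile[OF contracting_box_2] by simp
next
  case False
  then obtain \<kappa> K where "contracting_box d (35/100) (5/100) \<kappa> K"
    using contracting_box_ge_3[of d] assms by auto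
  then show ?thesis by (rule contracting_box.convergent_profile)
qed

section \<open>Convergence of the counts\<close>

lemma root_count_ratio:
  assumes "2 \<le> d"
  shows "root_count d (Suc n) (int k) / root_count d (Suc n) 0 = profile d n k ^ d"
  using root_count_eq_profile[OF assms, of n k] root_count_pos[OF assms, of "Suc n"] by simp

lemma root_count_abs:
  assumes "0 < d"
  shows "root_count d n k = root_count d n (int (nat \<bar>k\<bar>))"
  using root_count_uminus[OF assms, of n k] by (cases "0 \<le> k") auto

lemma convergent_root_count_ratio:
  assumes "2 \<le> d" "d \<le> 7"
  shows "convergent (\<lambda>n. root_count d n k / root_count d n 0)"
proof -
  have "convergent (\<lambda>n. profile d n (nat \<bar>k\<bar>) ^ d)"
    using convergent_profile[OF assms, of "nat \<bar>k\<bar>"]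
    unfolding convergent_def by (auto dest: tendsto_power)
  then have "convergent (\<lambda>n. root_count d (Suc n) (int (nat \<bar>k\<bar>)) / root_count d (Suc n) 0)"
    by (simp only: root_count_ratio[OF assms(1)])
  then have "convergent (\<lambda>n. root_count d (Suc n) k / root_count d (Suc n) 0)"
    using root_count_abs[of d _ k] assms by simp
  then show ?thesis by (simp only: convergent_Suc_iff[of "\<lambda>n. root_count d n k / root_count d n 0"])
qed

text \<open>Induction on the radius: the ball count at depth \<open>n + 1\<close> is a product of
  \<open>d\<close> ball counts at depth \<open>n\<close>, and the count at 0 becomes the
  \<open>d\<close>-th power of the old one times \<open>1 + 2 * ?q n\<close>. Each factor is thus
  normalised by the old count at 0.\<close>

lemma ball_count_convergent:
  assumes "2 \<le> d" "d \<le> 7"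
  shows "convergent (\<lambda>n. ball_count d n r g / root_count d n 0)"
proof (induction r arbitrary: g)
  case 0
  show ?case
  proof (cases "\<forall>v. v \<noteq> [] \<longrightarrow> g v = 0")
    case True
    show ?thesis
      unfolding ball_count_0 if_P[OF True] by (rule convergent_root_count_ratio[OF assms])
  next
    case False
    show ?thesis unfolding ball_count_0 if_not_P[OF False] by (simp add: convergent_const)
  qed
next
  case (Suc r)
  let ?q = "\<lambda>n. root_count d n 1 / root_count d n 0"
  have d: "0 < d" using assms by simp
  have "convergent (\<lambda>n. ball_count d (Suc n) (Suc r) g / root_count d (Suc n) 0)"
  proof (cases "(\<forall>i v. d \<le> i \<longrightarrow> g (i # v) = 0) \<and> (\<forall>i<d. \<bar>g [i] - g []\<bar> \<le> 1)")
    case True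
    have "ball_count d (Suc n) (Suc r) g / root_count d (Suc n) 0 =
        (\<Prod>i<d. ball_count d n r (\<lambda>v. g (i # v)) / root_count d n 0) / (1 + 2 * ?q n) ^ d" for n
    proof -
      have pos: "0 < root_count d n 0" using root_count_pos assms by simp
      have "root_count d n (-1) = root_count d n 1" using root_count_uminus[OF d, of n 1] by simp
      then have "root_count d (Suc n) 0 = (root_count d n 0 * (1 + 2 * ?q n)) ^ d"
        using pos by (simp add: root_count_Suc[OF d] algebra_simps)
      moreover have "ball_count d (Suc n) (Suc r) g = (\<Prod>i<d. ball_count d n r (\<lambda>v. g (i # v)))"
        unfolding ball_count_Suc if_P[OF True] ..
      ultimately show ?thesis by (simp add: prod_dividef power_mult_distrib)
    qed
    moreover have "convergent (\<lambda>n. (\<Prod>i<d. ball_count d n r (\<lambda>v. g (i # v)) / root_count d n 0)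
        / (1 + 2 * ?q n) ^ d)"
    proof -
      obtain L where L: "?q \<longlonglongrightarrow> L"
        using convergent_root_count_ratio[OF assms, of 1] by (auto simp: convergent_def)
      have "0 \<le> L" by (rule LIMSEQ_le_const[OF L]) simp
      then have "(1 + 2 * L) ^ d \<noteq> 0" by simp
      have "\<forall>i. \<exists>l. (\<lambda>n. ball_count d n r (\<lambda>v. g (i # v)) / root_count d n 0) \<longlonglongrightarrow> l"
        using Suc[of "\<lambda>v. g (_ # v)"] by (simp add: convergent_def)
      then obtain l where
        "\<And>i. (\<lambda>n. ball_count d n r (\<lambda>v. g (i # v)) / root_count d n 0) \<longlonglongrightarrow> l i"
        by metis
      then have "(\<lambda>n. (\<Prod>i<d. ball_count d n r (\<lambda>v. g (i # v)) / root_count d n 0)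
          / (1 + 2 * ?q n) ^ d) \<longlonglongrightarrow> (\<Prod>i<d. l i) / (1 + 2 * L) ^ d"
        using L \<open>(1 + 2 * L) ^ d \<noteq> 0\<close> by (intro tendsto_intros) auto
      then show ?thesis by (auto simp: convergent_def)
    qed
    ultimately show ?thesis by (simp only:)
  next
    case False
    show ?thesis unfolding ball_count_Suc if_not_P[OF False] by (simp add: convergent_const)
  qed
  then show ?case
    by (simp only: convergent_Suc_iff[of "\<lambda>n. ball_count d n (Suc r) g / root_count d n 0"])
qed

section \<open>The total count relative to the count at 0\<close>

lemma root_count_eq_0:
  assumes "0 < d" "int n < \<bar>k\<bar>"
  shows "root_count d n k = 0"
proof -
  have "{f \<in> lip0 d n. f [] = k} = {}"
    using lip0_root_bound[OF assms(1), of _ n] assms(2) by force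
  then show ?thesis by (simp only: root_count_def card.empty of_nat_0)
qed

lemma sum_symmetric_interval:
  fixes h :: "int \<Rightarrow> real"
  assumes "\<And>k. h (- k) = h k"
  shows "(\<Sum>k\<in>{-int n..int n}. h k) = h 0 + 2 * (\<Sum>k<n. h (int k + 1))"
proof (induction n)
  case (Suc n)
  have "{-int (Suc n)..int (Suc n)} =
      insert (- int (Suc n)) (insert (int (Suc n)) {-int n..int n})" by auto
  then show ?case using Suc assms[of "1 + int n"] by (simp add: add.commute)
qed simp

text \<open>The finite sum is written as a series, with terms 0 from index \<open>n\<close> on, so
  that its index set does not depend on \<open>n\<close>.\<close>

lemma card_lip0_ratio_sums:
  assumes "2 \<le> d"
  shows "(\<lambda>k. root_count d n (int k + 1) / root_count d n 0) sums
    ((real (card (lip0 d n)) / root_count d n 0 - 1) / 2)"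
proof -
  have d: "0 < d" using assms by simp
  have "real (card (lip0 d n)) =
      root_count d n 0 + 2 * (\<Sum>k<n. root_count d n (int k + 1))"
    unfolding card_lip0_eq_sum[OF d]
    by (rule sum_symmetric_interval) (rule root_count_uminus[OF d])
  then have "(real (card (lip0 d n)) / root_count d n 0 - 1) / 2 =
      (\<Sum>k<n. root_count d n (int k + 1) / root_count d n 0)"
    using root_count_pos[OF assms, of n] by (simp add: field_simps sum_divide_distrib[symmetric])
  then show ?thesis
    using sums_finite[of "{..<n}" "\<lambda>k. root_count d n (int k + 1) / root_count d n 0"]
    by (simp add: root_count_eq_0[OF d])
qed

text \<open>Dominated convergence for series, with majorant \<open>(1/2) ^ k\<close>.\<close>

lemma convergent_card_lip0_ratio:
  assumes "2 \<le> d" "d \<le> 7"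
  shows "convergent (\<lambda>n. real (card (lip0 d n)) / root_count d n 0)"
proof -
  let ?q = "\<lambda>k n. root_count d n (int k + 1) / root_count d n 0"
  have "\<forall>k. \<exists>l. ?q k \<longlonglongrightarrow> l"
    using convergent_root_count_ratio[OF assms] by (auto simp: convergent_def)
  then obtain l where l: "\<And>k. ?q k \<longlonglongrightarrow> l k" by metis
  have "?q k n \<le> (1/2) ^ k" for k n
    using root_count_geometric[OF assms(1), of n k] root_count_pos[OF assms(1), of n]
    by (simp add: divide_le_eq mult.commute)
  then have "eventually (\<lambda>(k, n). norm (?q k n) \<le> (1/2) ^ k) (at_top \<times>\<^sub>F sequentially)"
    by (intro always_eventually) simp
  moreover have "summable (\<lambda>k. (1/2::real) ^ k)" by (rule summable_geometric) simp
  ultimately have "(\<lambda>n. suminf (\<lambda>k. ?q k n)) \<longlonglongrightarrow> suminf l"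
    using tannerys_theorem[OF l, where M = "\<lambda>k. (1/2) ^ k"] by simp
  moreover have "suminf (\<lambda>k. ?q k n) = (real (card (lip0 d n)) / root_count d n 0 - 1) / 2" for n
    using card_lip0_ratio_sums[OF assms(1), of n] by (rule sums_unique[symmetric])
  ultimately have lim: "(\<lambda>n. (real (card (lip0 d n)) / root_count d n 0 - 1) / 2) \<longlonglongrightarrow> suminf l"
    by simp
  have "1 + 2 * ((a - 1) / 2) = a" for a :: real by (simp add: field_simps)
  then have "(\<lambda>n. real (card (lip0 d n)) / root_count d n 0) \<longlonglongrightarrow> 1 + 2 * suminf l"
    using tendsto_add[OF tendsto_const[of 1] tendsto_mult[OF tendsto_const[of 2] lim]]
    by (simp only:)
  then show ?thesis by (auto simp: convergent_def)
qed

section \<open>Tightness and the limit measures\<close>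

text \<open>Fatou's lemma shows that the pointwise limit has mass at most 1; tightness prevents mass
  from escaping, so it is exactly 1.\<close>

lemma pmf_limit_of_tight:
  fixes p :: "nat \<Rightarrow> 'a pmf"
  assumes conv: "\<And>x. convergent (\<lambda>n. pmf (p n) x)"
    and tight: "\<And>\<epsilon>::real. 0 < \<epsilon> \<Longrightarrow> \<exists>S. finite S \<and> (\<forall>n. 1 - \<epsilon> \<le> measure_pmf.prob (p n) S)"
  shows "\<exists>P. \<forall>x. (\<lambda>n. pmf (p n) x) \<longlonglongrightarrow> pmf P x"
proof -
  define q where "q x = lim (\<lambda>n. pmf (p n) x)" for x
  have q: "(\<lambda>n. pmf (p n) x) \<longlonglongrightarrow> q x" for x
    using conv[of x] by (simp add: q_def convergent_LIMSEQ_iff)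
  have nonneg: "0 \<le> q x" for x
    by (rule LIMSEQ_le_const[OF q]) simp
  let ?I = "\<integral>\<^sup>+x. ennreal (q x) \<partial>count_space UNIV"
  have "?I \<le> 1"
  proof -
    have "?I = (\<integral>\<^sup>+x. liminf (\<lambda>n. ennreal (pmf (p n) x)) \<partial>count_space UNIV)"
      by (intro nn_integral_cong lim_imp_Liminf[symmetric] tendsto_ennrealI q) simp
    also have "\<dots> \<le> liminf (\<lambda>n. \<integral>\<^sup>+x. ennreal (pmf (p n) x) \<partial>count_space UNIV)"
      by (rule nn_integral_liminf) simp
    also have "\<dots> = 1" by (simp add: nn_integral_pmf_eq_1 Liminf_const)
    finally show ?thesis .
  qed
  moreover have "1 \<le> ?I"
  proof (rule ennreal_le_epsilon)
    fix e :: real assume "0 < e"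
    then obtain S where S: "finite S" and pS: "\<And>n. 1 - e \<le> measure_pmf.prob (p n) S"
      using tight by blast
    have "(\<lambda>n. \<Sum>x\<in>S. pmf (p n) x) \<longlonglongrightarrow> (\<Sum>x\<in>S. q x)"
      by (intro tendsto_sum q)
    then have "1 - e \<le> (\<Sum>x\<in>S. q x)"
      by (rule LIMSEQ_le_const) (use pS S in \<open>auto simp: measure_measure_pmf_finite\<close>)
    then have "1 \<le> ennreal ((\<Sum>x\<in>S. q x) + e)" by simp
    also have "\<dots> = ennreal (\<Sum>x\<in>S. q x) + ennreal e"
      using \<open>0 < e\<close> by (intro ennreal_plus sum_nonneg nonneg) auto
    also have "ennreal (\<Sum>x\<in>S. q x) = (\<integral>\<^sup>+x. ennreal (q x) \<partial>count_space S)"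
      using S nonneg by (simp add: nn_integral_count_space_finite sum_ennreal)
    also have "\<dots> = (\<integral>\<^sup>+x. ennreal (q x) * indicator S x \<partial>count_space UNIV)"
      by (rule nn_integral_count_space_indicator) simp
    also have "\<dots> \<le> ?I"
      by (intro nn_integral_mono) (simp add: indicator_def)
    finally show "1 \<le> ?I + ennreal e" by simp
  qed
  ultimately have "?I = 1" by (rule antisym)
  then have "pmf (embed_pmf q) x = q x" for x
    using nonneg by (intro pmf_embed_pmf) auto
  then show ?thesis using q by metis
qed

lemma lip0_abs_bound:
  assumes "f \<in> lip0 d n"
  shows "\<bar>f v\<bar> \<le> \<bar>f []\<bar> + int (length v)"
  using assms
proof (induction v arbitrary: f n)
  case (Cons i w)
  show ?case
  proof (cases n)
    case 0
    then show ?thesis using Cons.prems by (simp add: lip0_0)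
  next
    case (Suc m)
    show ?thesis
    proof (cases "i < d")
      case True
      then have "(\<lambda>v. f (i # v)) \<in> lip0 d m" "\<bar>f [i] - f []\<bar> \<le> 1"
        using Cons.prems by (auto simp: Suc lip0_Suc_iff)
      with Cons.IH[of "\<lambda>v. f (i # v)" m] show ?thesis by simp
    next
      case False
      then show ?thesis using Cons.prems by (simp add: Suc lip0_Suc_iff)
    qed
  qed
qed simp

lemma finite_tree_verts: "finite (tree_verts d r)"
proof -
  have "finite {v. set v \<subseteq> {..<d} \<and> length v \<le> r}" by (rule finite_lists_length_le) simp
  then show ?thesis by (simp add: tree_verts_def conj_commute)
qed

text \<open>Carrying the exact remainder makes the induction close.\<close>

lemma geometric_tail:
  "(\<Sum>k<n. if K \<le> k then (1/2::real) ^ k else 0) + 2 * (1/2) ^ max n K = 2 * (1/2) ^ K"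
proof (induction n)
  case (Suc n)
  then show ?case by (cases "K \<le> n") (auto simp: max_def split: if_splits)
qed simp

lemma root_count_le_0:
  assumes "2 \<le> d"
  shows "root_count d n k \<le> root_count d n 0"
proof (cases "k = 0")
  case False
  define j where "j = nat (\<bar>k\<bar> - 1)"
  have "int (nat \<bar>k\<bar>) = int j + 1" using False by (simp add: j_def)
  then have "root_count d n k = root_count d n (int j + 1)"
    using root_count_abs[of d n k] assms by simp
  also have "\<dots> \<le> root_count d n 0 * (1/2) ^ j" by (rule root_count_geometric[OF assms])
  also have "\<dots> \<le> root_count d n 0 * 1"
    by (intro mult_left_mono power_le_one) auto
  finally show ?thesis by simp
qed simp

text \<open>The factor 4 is 2 for the two signs times 2 for the geometric tail from index
  \<open>K\<close>; the count at 0 is at most the total.\<close>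

lemma prob_root_large:
  assumes "2 \<le> d"
  shows "measure_pmf.prob (pmf_of_set (lip0 d n)) {f. int K < \<bar>f []\<bar>} \<le> 4 * (1/2) ^ K"
proof -
  have d: "0 < d" using assms by simp
  let ?Z = "root_count d n" and ?h = "\<lambda>k. if int K < \<bar>k\<bar> then root_count d n k else 0"
  let ?B = "\<lambda>k. {f \<in> lip0 d n. f [] = k \<and> int K < \<bar>k\<bar>}"
  have "lip0 d n \<inter> {f. int K < \<bar>f []\<bar>} = (\<Union>k\<in>{-int n..int n}. ?B k)"
    using lip0_root_bound[OF d, of _ n] by (fastforce simp: abs_le_iff)
  then have "card (lip0 d n \<inter> {f. int K < \<bar>f []\<bar>}) = card (\<Union>k\<in>{-int n..int n}. ?B k)"
    by (simp only:)
  also have "\<dots> = (\<Sum>k\<in>{-int n..int n}. card (?B k))"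
    by (intro card_UN_disjoint) (use finite_lip0[OF d] in auto)
  finally have "real (card (lip0 d n \<inter> {f. int K < \<bar>f []\<bar>})) = (\<Sum>k\<in>{-int n..int n}. real (card (?B k)))"
    by simp
  also have "\<dots> = (\<Sum>k\<in>{-int n..int n}. ?h k)"
    by (intro sum.cong refl) (simp add: root_count_def)
  also have "\<dots> = ?h 0 + 2 * (\<Sum>k<n. ?h (int k + 1))"
    by (rule sum_symmetric_interval) (simp add: root_count_uminus[OF d])
  also have "\<dots> = 2 * (\<Sum>k<n. ?h (int k + 1))" by simp
  also have "(\<Sum>k<n. ?h (int k + 1)) \<le> (\<Sum>k<n. ?Z 0 * (if K \<le> k then (1/2) ^ k else 0))"
    by (intro sum_mono) (auto simp: root_count_geometric[OF assms])
  also have "\<dots> = ?Z 0 * (\<Sum>k<n. if K \<le> k then (1/2) ^ k else 0)"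
    by (simp only: sum_distrib_left)
  also have "\<dots> \<le> ?Z 0 * (2 * (1/2) ^ K)"
  proof (intro mult_left_mono)
    have "0 \<le> 2 * (1/2::real) ^ max n K" by simp
    then show "(\<Sum>k<n. if K \<le> k then (1/2::real) ^ k else 0) \<le> 2 * (1/2) ^ K"
      using geometric_tail[of K n] by linarith
  qed simp
  also have "?Z 0 \<le> real (card (lip0 d n))"
    unfolding root_count_def using finite_lip0[OF d, of n] by (auto intro: card_mono)
  finally have "real (card (lip0 d n \<inter> {f. int K < \<bar>f []\<bar>})) \<le> real (card (lip0 d n)) * (4 * (1/2) ^ K)"
    by (simp add: mult_right_mono)
  moreover have "lip0 d n \<noteq> {}" using zero_in_lip0 by blast
  moreover have "0 < card (lip0 d n)"
    using finite_lip0[OF d, of n] \<open>lip0 d n \<noteq> {}\<close> by (simp add: card_gt_0_iff)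
  ultimately show ?thesis
    using finite_lip0[OF d, of n]
    by (simp add: measure_pmf_of_set divide_le_eq mult.commute)
qed

lemma mu_local_tight:
  assumes "2 \<le> d" and "0 < \<epsilon>"
  shows "\<exists>S. finite S \<and> (\<forall>n. 1 - \<epsilon> \<le> measure_pmf.prob (mu_local d n r) S)"
proof -
  obtain K where "(1/2::real) ^ K < \<epsilon> / 4"
    using real_arch_pow_inv[of "\<epsilon> / 4" "1/2"] assms(2) by auto
  then have K: "4 * (1/2::real) ^ K < \<epsilon>" by simp
  \<comment> \<open>A root value of size at most \<open>K\<close> can grow by at most
    \<open>r\<close> within the ball.\<close>
  define S where "S = {g. \<forall>v. (v \<in> tree_verts d r \<longrightarrow> g v \<in> {- int (K + r)..int (K + r)}) \<and>
    (v \<notin> tree_verts d r \<longrightarrow> g v = 0)}"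
  have "finite S"
    unfolding S_def by (rule finite_set_of_finite_funs) (simp_all add: finite_tree_verts)
  moreover have "1 - \<epsilon> \<le> measure_pmf.prob (mu_local d n r) S" for n
  proof -
    let ?M = "pmf_of_set (lip0 d n)" and ?R = "restrict_ball d r"
    have supp: "set_pmf ?M = lip0 d n"
      using finite_lip0[of d n] zero_in_lip0 assms(1) by (intro set_pmf_of_set) auto
    have in_S: "?R f \<in> S" if f: "f \<in> lip0 d n" and "\<bar>f []\<bar> \<le> int K" for f
    proof -
      have "f v \<in> {- int (K + r)..int (K + r)}" if "v \<in> tree_verts d r" for v
        using lip0_abs_bound[OF f, of v] that \<open>\<bar>f []\<bar> \<le> int K\<close> by (auto simp: tree_verts_def)
      then show ?thesis by (simp add: S_def restrict_ball_def)
    qed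
    have "1 - \<epsilon> \<le> 1 - measure_pmf.prob ?M {f. int K < \<bar>f []\<bar>}"
      using prob_root_large[OF assms(1), of n K] K by linarith
    also have "\<dots> = measure_pmf.prob ?M (UNIV - {f. int K < \<bar>f []\<bar>})"
      using measure_pmf.prob_compl[of "{f. int K < \<bar>f []\<bar>}" ?M] by simp
    also have "\<dots> \<le> measure_pmf.prob ?M (?R -` S)"
    proof (rule measure_pmf.finite_measure_mono_AE)
      show "AE f in measure_pmf ?M. f \<in> UNIV - {f. int K < \<bar>f []\<bar>} \<longrightarrow> f \<in> ?R -` S"
        using in_S by (auto simp: AE_measure_pmf_iff supp)
    qed simp
    also have "\<dots> = measure_pmf.prob (mu_local d n r) S"
      by (simp add: mu_local_def)
    finally show ?thesis .
  qed
  ultimately show ?thesis by blast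
qed

text \<open>Each point mass is the ball count over the total count, both divided by the count at 0.
  Numerator and denominator converge, and the denominator stays at least 1.\<close>

lemma local_weak_conv_le_7:
  assumes "2 \<le> d" "d \<le> 7"
  shows "local_weak_conv d"
  unfolding local_weak_conv_def
proof (intro allI pmf_limit_of_tight)
  show "\<exists>S. finite S \<and> (\<forall>n. 1 - \<epsilon> \<le> measure_pmf.prob (mu_local d n r) S)"
    if "0 < \<epsilon>" for r and \<epsilon> :: real
    using mu_local_tight[OF assms(1) that] .
  show "convergent (\<lambda>n. pmf (mu_local d n r) g)" for r g
  proof -
    have d: "0 < d" using assms by simp
    let ?c = "\<lambda>n. real (card (lip0 d n)) / root_count d n 0"
    obtain L where L: "?c \<longlonglongrightarrow> L"
      using convergent_card_lip0_ratio[OF assms] by (auto simp: convergent_def)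
    obtain l where l: "(\<lambda>n. ball_count d n r g / root_count d n 0) \<longlonglongrightarrow> l"
      using ball_count_convergent[OF assms] by (auto simp: convergent_def)
    have pos: "0 < root_count d n 0" for n using root_count_pos assms by simp
    have "1 \<le> ?c n" for n
    proof -
      have "root_count d n 0 \<le> real (card (lip0 d n))"
        unfolding root_count_def using finite_lip0[OF d, of n] by (auto intro: card_mono)
      then show ?thesis using pos[of n] by simp
    qed
    then have "1 \<le> L" by (intro LIMSEQ_le_const[OF L]) auto
    then have "(\<lambda>n. (ball_count d n r g / root_count d n 0) / ?c n) \<longlonglongrightarrow> l / L"
      by (intro tendsto_divide l L) auto
    moreover have "(ball_count d n r g / root_count d n 0) / ?c n = pmf (mu_local d n r) g" for n
      using pos[of n] by (simp add: pmf_mu_local[OF d])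
    ultimately show ?thesis by (auto simp: convergent_def)
  qed
qed

section \<open>Oscillation in high degree\<close>

text \<open>With \<open>y = 8/10 * t\<close>, Bernoulli gives
  \<open>1 + y \<le> (1 + y / d) ^ d\<close>, which absorbs the extra factor. Then
  \<open>(1 + y) * (1 + y / d) \<le> 1 + t\<close>, because
  \<open>8/10 * (1 + 11/80) = 91/100\<close>.\<close>

lemma power_Suc_shrink:
  fixes t :: real
  assumes "8 \<le> d" "0 \<le> t" "t \<le> 104/1000"
  shows "(1 + 8/10 * t) ^ Suc d \<le> (1 + t) ^ d"
proof -
  define y e where "y = 8/10 * t" and "e = 1 / real d"
  have e: "0 \<le> e" "e \<le> 1/8" "real d * e = 1"
    using assms(1) by (simp_all add: e_def divide_le_eq)
  have y: "0 \<le> y" "y \<le> 1/10" using assms by (simp_all add: y_def)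
  have "y * (1 + y) * e \<le> y * (11/10) * (1/8)"
    using y e by (intro mult_mono) auto
  then have "y + y * (1 + y) * e \<le> t" using assms(2) y_def by linarith
  moreover have "(1 + y) * (1 + y * e) = 1 + (y + y * (1 + y) * e)" by (simp add: algebra_simps)
  ultimately have "((1 + y) * (1 + y * e)) ^ d \<le> (1 + t) ^ d"
    using y e by (intro power_mono) auto
  moreover have "1 + real d * (y * e) \<le> (1 + y * e) ^ d"
    using y e by (intro Bernoulli_inequality) (auto intro: order_trans[of "-1" 0])
  then have "1 + y \<le> (1 + y * e) ^ d" using e(3) by (simp add: mult.left_commute)
  then have "(1 + y) ^ d * (1 + y) \<le> (1 + y) ^ d * (1 + y * e) ^ d"
    using y by (intro mult_left_mono) auto
  ultimately show ?thesis
    unfolding y_def[symmetric] by (simp add: power_mult_distrib mult.commute)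
qed

text \<open>Writing \<open>(1 + 2\<alpha>) / (1 + \<alpha>) = 1 + t\<close>, raising the degree by one shrinks \<open>t\<close>
  by a factor at most 0.8, which outweighs the additional factor \<open>1 + t\<close>.\<close>
lemma low_to_high_power:
  fixes \<alpha> :: real
  assumes "8 \<le> d" and \<alpha>: "\<alpha> = (7633/10000) ^ d"
  shows "45/100 \<le> ((1 + \<alpha>) / (1 + 2 * \<alpha>)) ^ d"
proof -
  \<comment> \<open>The bound 20/9 is the reciprocal of 45/100, and the last condition says that
    \<open>1 + t\<close> is at least \<open>(1 + 2 * \<alpha>) / (1 + \<alpha>)\<close>.\<close>
  have "\<exists>t. 0 \<le> t \<and> t \<le> 104/1000 \<and> (1 + t) ^ d \<le> 20/9 \<and>
      (7633/10000) ^ d \<le> t * (1 + (7633/10000::real) ^ d)"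
    using assms(1)
  proof (induction d rule: dec_induct)
    case base
    \<comment> \<open>At \<open>d = 8\<close>, \<open>\<alpha> / (1 + \<alpha>)\<close> is about
      0.1033 and the eighth power of 1.104 about 2.207.\<close>
    show ?case by (rule exI[of _ "104/1000"]) (simp add: power_divide)
  next
    case (step d)
    define a where "a = (7633/10000::real) ^ d"
    from step obtain t where t: "0 \<le> t" "t \<le> 104/1000" "(1 + t) ^ d \<le> 20/9" "a \<le> t * (1 + a)"
      unfolding a_def by blast
    have a: "0 \<le> a" by (simp add: a_def)
    have "t * (1 + a) \<le> 104/1000 * (1 + a)" using t a by (intro mult_right_mono) auto
    with t(4) have a_le: "a \<le> 12/100" by simp
    have "7633/10000 * a \<le> 7633/10000 * (t * (1 + a))" using t(4) by simp
    also have "\<dots> = t * (7633/10000 * (1 + a))" by simp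
    also have "\<dots> \<le> t * (8/10 * (1 + 7633/10000 * a))"
      by (rule mult_left_mono[OF _ t(1)]) (use a_le in simp)
    also have "\<dots> = (8/10 * t) * (1 + 7633/10000 * a)"
      by (simp only: mult.assoc mult.left_commute)
    finally have "7633/10000 * a \<le> (8/10 * t) * (1 + 7633/10000 * a)" .
    moreover have "(1 + 8/10 * t) ^ Suc d \<le> 20/9"
      using power_Suc_shrink[OF step(1) t(1,2)] t(3) by linarith
    ultimately show ?case
      using t(1,2) by (intro exI[of _ "8/10 * t"]) (auto simp: a_def)
  qed
  then obtain t where t: "0 \<le> t" "(1 + t) ^ d \<le> 20/9" "\<alpha> \<le> t * (1 + \<alpha>)"
    unfolding \<alpha> by blast
  have a: "0 \<le> \<alpha>" by (simp add: \<alpha>)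
  have "1 / (1 + t) \<le> (1 + \<alpha>) / (1 + 2 * \<alpha>)"
    using t a by (simp add: divide_simps algebra_simps)
  then have "(1 / (1 + t)) ^ d \<le> ((1 + \<alpha>) / (1 + 2 * \<alpha>)) ^ d"
    using t by (intro power_mono) auto
  moreover have "45/100 \<le> (1 / (1 + t)) ^ d"
    using t by (simp add: power_divide divide_simps)
  ultimately show ?thesis by linarith
qed

lemma step_antimono:
  fixes x a :: real
  assumes "0 \<le> x" "x \<le> a"
  shows "(1 + a) / (1 + 2 * a) \<le> (1 + x) / (1 + 2 * x)"
proof -
  have "1 / (1 + 2 * a) \<le> 1 / (1 + 2 * x)" using assms by (simp add: frac_le)
  moreover have "(1 + z) / (1 + 2 * z) = 1/2 + 1/2 * (1 / (1 + 2 * z))" if "0 \<le> z" for z :: real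
    using that by (simp add: field_simps)
  from this[of a] this[of x]
  have "(1 + a) / (1 + 2 * a) = 1/2 + 1/2 * (1 / (1 + 2 * a))"
    "(1 + x) / (1 + 2 * x) = 1/2 + 1/2 * (1 / (1 + 2 * x))"
    using assms by linarith+
  ultimately show ?thesis by linarith
qed

text \<open>The first entry starts at 1. A high value forces the next one to be low and conversely;
  \<open>p 2 ^ d\<close> is too small to break this alternation.\<close>

lemma profile_oscillates:
  assumes d: "8 \<le> d"
  shows "45/100 \<le> profile d (2 * m) 1 ^ d \<and> profile d (2 * m + 1) 1 ^ d \<le> (7633/10000) ^ d"
proof -
  interpret profile_box d "35/100" "5/100" by (rule profile_box_ge_3) (use d in simp)
  define \<alpha> where "\<alpha> = (7633/10000::real) ^ d"
  have small: "(35/100::real) ^ d \<le> 27/100000"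
  proof -
    have "(35/100::real) ^ d \<le> (35/100) ^ 8" using d by (intro power_decreasing) auto
    also have "\<dots> \<le> 27/100000" by (simp add: power_divide)
    finally show ?thesis .
  qed
  have step1: "profile d (Suc n) 1 =
      (1 + profile d n 1 ^ d + profile d n 2 ^ d) / (1 + 2 * profile d n 1 ^ d)" for n
    by (simp add: profile_step_def numeral_2_eq_2)
  have down: "profile d (Suc n) 1 ^ d \<le> \<alpha>" if "45/100 \<le> profile d n 1 ^ d" for n
  proof -
    let ?p = "profile d n"
    have "0 \<le> ?p 2 ^ d" "?p 2 ^ d \<le> (35/100) ^ d"
      using box_powers(2)[OF in_box_profile[of n]] by auto
    \<comment> \<open>The constant is exactly
      \<open>(1 + 45/100 + 27/100000) / (1 + 2 * 45/100)\<close>.\<close>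
    with that small have "profile d (Suc n) 1 \<le> 7633/10000"
      unfolding step1 by (simp add: divide_le_eq)
    moreover have "0 \<le> profile d (Suc n) 1"
      using in_box_profile[of "Suc n"] unfolding in_box_def by auto
    ultimately show ?thesis unfolding \<alpha>_def by (rule power_mono)
  qed
  have up: "45/100 \<le> profile d (Suc n) 1 ^ d" if "profile d n 1 ^ d \<le> \<alpha>" for n
  proof -
    let ?p = "profile d n"
    have x: "0 \<le> ?p 1 ^ d" "0 \<le> ?p 2 ^ d" and a: "0 \<le> \<alpha>"
      using box_powers(2)[OF in_box_profile[of n]] in_box_profile[of n]
      by (auto simp: \<alpha>_def in_box_def)
    have "(1 + \<alpha>) / (1 + 2 * \<alpha>) \<le> (1 + ?p 1 ^ d) / (1 + 2 * ?p 1 ^ d)"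
      using x(1) that by (rule step_antimono)
    also have "\<dots> \<le> profile d (Suc n) 1"
      unfolding step1 using x by (simp add: divide_right_mono)
    finally have "((1 + \<alpha>) / (1 + 2 * \<alpha>)) ^ d \<le> profile d (Suc n) 1 ^ d"
      using a by (intro power_mono) auto
    with low_to_high_power[OF d \<alpha>_def] show ?thesis by linarith
  qed
  have "45/100 \<le> profile d (2 * m) 1 ^ d"
  proof (induction m)
    case (Suc m)
    have "45/100 \<le> profile d (Suc (Suc (2 * m))) 1 ^ d" by (rule up[OF down[OF Suc]])
    then show ?case by simp
  qed simp
  with down[of "2 * m"] show ?thesis by (simp add: \<alpha>_def)
qed

text \<open>Radius 0 suffices. The two parities force a limit to satisfy both
  \<open>45/100 * P(0) \<le> P(1)\<close> and \<open>P(1) \<le> 2/10 * P(0)\<close>, so the mass at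
  0 vanishes. Since 0 is the most likely root value at every depth, all masses vanish, which no
  probability measure allows.\<close>

lemma not_local_weak_conv_ge_8:
  assumes d: "8 \<le> d"
  shows "\<not> local_weak_conv d"
proof
  assume "local_weak_conv d"
  then obtain P where P: "\<And>g. (\<lambda>n. pmf (mu_local d n 0) g) \<longlonglongrightarrow> pmf P g"
    unfolding local_weak_conv_def by blast
  have d0: "0 < d" and d2: "2 \<le> d" using d by auto
  define \<delta> :: "int \<Rightarrow> nat list \<Rightarrow> int"
    where "\<delta> k = (\<lambda>v. if v = [] then k else 0)" for k
  let ?\<mu> = "\<lambda>n. mu_local d n 0"
  have root: "pmf (?\<mu> n) (\<delta> k) = root_count d n k / real (card (lip0 d n))" for n k
    by (simp add: pmf_mu_local[OF d0] ball_count_0 \<delta>_def)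
  have max: "pmf (?\<mu> n) g \<le> pmf (?\<mu> n) (\<delta> 0)" for n g
  proof -
    have "ball_count d n 0 g \<le> root_count d n 0"
      using root_count_le_0[OF d2] unfolding ball_count_0 by simp
    then show ?thesis
      unfolding root[of n 0] by (subst pmf_mu_local[OF d0]) (rule divide_right_mono, auto)
  qed
  have ratio: "pmf (?\<mu> (Suc n)) (\<delta> 1) = profile d n 1 ^ d * pmf (?\<mu> (Suc n)) (\<delta> 0)" for n
    using root_count_eq_profile[OF d2, of n 1] by (simp add: root)
  \<comment> \<open>The names refer to the parity of the profile index, which is one below the
    depth.\<close>
  have even: "(\<lambda>m. pmf (?\<mu> (Suc (2 * m))) g) \<longlonglongrightarrow> pmf P g"
    and odd: "(\<lambda>m. pmf (?\<mu> (Suc (2 * m + 1))) g) \<longlonglongrightarrow> pmf P g" for g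
    using LIMSEQ_subseq_LIMSEQ[OF P, of "\<lambda>m. Suc (2 * m)"]
      LIMSEQ_subseq_LIMSEQ[OF P, of "\<lambda>m. Suc (2 * m + 1)"]
    by (simp_all add: strict_mono_def o_def)
  have "45/100 * pmf P (\<delta> 0) \<le> pmf P (\<delta> 1)"
  proof (rule LIMSEQ_le[OF tendsto_mult[OF tendsto_const even] even])
    show "\<exists>N. \<forall>n\<ge>N. 45/100 * pmf (?\<mu> (Suc (2 * n))) (\<delta> 0) \<le> pmf (?\<mu> (Suc (2 * n))) (\<delta> 1)"
      unfolding ratio using profile_oscillates[OF d]
      by (intro exI[of _ 0] allI impI mult_right_mono) auto
  qed
  moreover have "pmf P (\<delta> 1) \<le> (7633/10000) ^ d * pmf P (\<delta> 0)"
  proof (rule LIMSEQ_le[OF odd tendsto_mult[OF tendsto_const odd]])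
    show "\<exists>N. \<forall>n\<ge>N. pmf (?\<mu> (Suc (2 * n + 1))) (\<delta> 1)
        \<le> (7633/10000) ^ d * pmf (?\<mu> (Suc (2 * n + 1))) (\<delta> 0)"
      unfolding ratio using profile_oscillates[OF d]
      by (intro exI[of _ 0] allI impI mult_right_mono) auto
  qed
  moreover have "(7633/10000::real) ^ d \<le> 2/10"
  proof -
    have "(7633/10000::real) ^ d \<le> (7633/10000) ^ 8" using d by (intro power_decreasing) auto
    also have "\<dots> \<le> 2/10" by (simp add: power_divide)
    finally show ?thesis .
  qed
  then have "(7633/10000) ^ d * pmf P (\<delta> 0) \<le> 2/10 * pmf P (\<delta> 0)"
    by (intro mult_right_mono) auto
  ultimately have zero: "pmf P (\<delta> 0) \<le> 0" by linarith
  have "pmf P g \<le> pmf P (\<delta> 0)" for g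
    by (rule LIMSEQ_le[OF P P]) (use max in blast)
  with zero have "pmf P g = 0" for g
    by (metis order_trans order_antisym pmf_nonneg)
  then show False using set_pmf_not_empty[of P] by (auto simp: set_pmf_iff)
qed

theorem theorem1p1:
  fixes d :: nat
  assumes "d \<ge> 2"
  shows "local_weak_conv d \<longleftrightarrow> d \<le> 7"
proof
  show "local_weak_conv d \<Longrightarrow> d \<le> 7"
    using not_local_weak_conv_ge_8[of d] by linarith
qed (rule local_weak_conv_le_7[OF assms])

end
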